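(* Assume $\mathrm{cov}(\mathcal M)=\mathfrak c$ and $\mathfrak c$ is regular. Then there are ultrafilters $U,\tilde U$, a $U$-scale $X$ and a $\tilde U$-scale $Y$ such that $X\cup\mathrm{Fin}$ and $Y\cup\mathrm{Fin}$ satisfy $\mathsf S_1(\Omega_{\mathrm{Bor}},\Omega_{\mathrm{Bor}})$ but the product space $(X\cup\mathrm{Fin})\times(Y\cup\mathrm{Fin})$ is not Menger. In fact, $X$ and $Y$ themselves satisfy $\mathsf S_1(\Omega_{\mathrm{Bor}},\Omega_{\mathrm{Bor}})$ and $X\times Y$ is not Menger.
   Context: All subsets of $\mathcal P(\omega)$ carry the Cantor-space topology; $\mathrm{Fin}$ is the set of finite subsets of $\omega$ and elements of $[\omega]^\omega$ are identified with increasing enumerations. $\mathrm{cov}(\mathcal M)$ is the least number of meager sets covering $[\omega]^\omega$; $\mathfrak c=2^{\aleph_0}$. Ultrafilter: nonprincipal ultrafilter $U\subseteq[\omega]^\omega$. $a\le_U b$ iff $\{n:a(n)\le b(n)\}\in U$; $\mathfrak b(U)$ is the least size of a $\le_U$-unbounded subset of $[\omega]^\omega$; $U^+=\{a:\omega\setminus a\notin U\}$. $X\subseteq[\omega]^\omega$ is a $U$-scale if $|X|\ge\mathfrak b(U)$ and for every $d$ there are $c$ and $S\subseteq X$, $|S|<\mathfrak b(U)$, with $d\le_{U^+}c\le_U x$ for all $x\in X\setminus S$. $\mathsf S_1(\Omega_{\mathrm{Bor}},\Omega_{\mathrm{Bor}})$: for every sequence $\mathcal U_n$ of countable Borel $\omega$-covers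 (countable families of Borel sets, the space not a member, every finite set contained in a member) there are $U_n\in\mathcal U_n$ with $\{U_n\}$ an $\omega$-cover. A space is Menger if for every sequence of open covers $\mathcal U_n$ there are finite $\mathcal F_n\subseteq\mathcal U_n$ with $\bigcup_n\mathcal F_n$ a cover. *)

theory Defs
  imports "HOL-Analysis.Analysis" "HOL-Library.Infinite_Set"
begin

unbundle cardinal_syntax

section \<open>Cardinals\<close>

text \<open>The cardinal of a smallest set satisfying \<open>P\<close>; it is meaningful only if some set satisfies
  \<open>P\<close>, see \<open>least_card_attained\<close>.\<close>

definition least_card :: "('a set \<Rightarrow> bool) \<Rightarrow> 'a rel" where
  "least_card P = |SOME A. P A \<and> (\<forall>B. P B \<longrightarrow> |A| \<le>o |B| )|"

lemma least_card_attained: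
  assumes "P A"
  obtains B where "P B" "least_card P = |B|" "\<And>C. P C \<Longrightarrow> least_card P \<le>o |C|"
proof -
  let ?R = "{|B| | B. P B}"
  have "?R \<noteq> {}" "\<forall>r\<in>?R. Well_order r"
    using assms by (auto intro: card_of_Well_order)
  from exists_minim_Well_order[OF this]
  have "\<exists>B. P B \<and> (\<forall>C. P C \<longrightarrow> |B| \<le>o |C| )"
    by blast
  from someI_ex[OF this] show thesis
    by (intro that) (auto simp: least_card_def)
qed

definition continuum :: "(nat \<Rightarrow> bool) rel" where
  "continuum = ctwo ^c natLeq"


section \<open>The Cantor space of sets of natural numbers\<close>

definition cantor :: "nat set topology" where
  "cantor = pullback_topology UNIV (\<lambda>A n. n \<in> A)
     (product_topology (\<lambda>_. discrete_topology (UNIV :: bool set)) UNIV)"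

definition Fin :: "nat set set" where
  "Fin = {a. finite a}"

definition infsets :: "nat set set" where
  "infsets = {a. infinite a}"

definition nowhere_dense_in :: "'a topology \<Rightarrow> 'a set \<Rightarrow> bool" where
  "nowhere_dense_in T A \<longleftrightarrow> A \<subseteq> topspace T \<and> T interior_of (T closure_of A) = {}"

definition meager_in :: "'a topology \<Rightarrow> 'a set \<Rightarrow> bool" where
  "meager_in T A \<longleftrightarrow> (\<exists>\<N>. countable \<N> \<and> (\<forall>N\<in>\<N>. nowhere_dense_in T N) \<and> A = \<Union>\<N>)"

definition cov_meager :: "nat set set rel" where
  "cov_meager = least_card (\<lambda>\<F>. (\<forall>M\<in>\<F>. meager_in (subtopology cantor infsets) M) \<and> infsets \<subseteq> \<Union>\<F>)"


section \<open>Ultrafilters and scales\<close>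

text \<open>Nonprincipality is expressed by requiring all members to be infinite; in particular
  the empty set is not a member.\<close>

definition ultrafilter :: "nat set set \<Rightarrow> bool" where
  "ultrafilter U \<longleftrightarrow> U \<subseteq> infsets \<and> UNIV \<in> U
     \<and> (\<forall>a\<in>U. \<forall>b\<in>U. a \<inter> b \<in> U)
     \<and> (\<forall>a\<in>U. \<forall>b. a \<subseteq> b \<longrightarrow> b \<in> U)
     \<and> (\<forall>a. a \<in> U \<or> - a \<in> U)"

text \<open>An infinite set \<open>a\<close> is identified with its increasing enumeration \<open>enumerate a\<close>.\<close>

definition le_mod :: "nat set set \<Rightarrow> nat set \<Rightarrow> nat set \<Rightarrow> bool" where
  "le_mod U a b \<longleftrightarrow> {n. enumerate a n \<le> enumerate b n} \<in> U"

definition positive_sets :: "nat set set \<Rightarrow> nat set set" where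
  "positive_sets U = {a. - a \<notin> U}"

definition unbounded_mod :: "nat set set \<Rightarrow> nat set set \<Rightarrow> bool" where
  "unbounded_mod U B \<longleftrightarrow> B \<subseteq> infsets \<and> \<not> (\<exists>b\<in>infsets. \<forall>a\<in>B. le_mod U a b)"

definition bounding_number :: "nat set set \<Rightarrow> nat set rel" where
  "bounding_number U = least_card (unbounded_mod U)"

definition U_scale :: "nat set set \<Rightarrow> nat set set \<Rightarrow> bool" where
  "U_scale U X \<longleftrightarrow> X \<subseteq> infsets \<and> bounding_number U \<le>o |X| \<and>
     (\<forall>d\<in>infsets. \<exists>c\<in>infsets. \<exists>S\<subseteq>X. |S| <o bounding_number U \<and>
        (\<forall>x\<in>X - S. le_mod (positive_sets U) d c \<and> le_mod U c x))"


section \<open>Covering properties\<close>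

definition borel_sets_of :: "'a topology \<Rightarrow> 'a set set" where
  "borel_sets_of T = sigma_sets (topspace T) {V. openin T V}"

definition borel_omega_cover :: "'a topology \<Rightarrow> 'a set set \<Rightarrow> bool" where
  "borel_omega_cover T \<U> \<longleftrightarrow> countable \<U> \<and> \<U> \<subseteq> borel_sets_of T \<and> topspace T \<notin> \<U> \<and>
     (\<forall>F. finite F \<and> F \<subseteq> topspace T \<longrightarrow> (\<exists>V\<in>\<U>. F \<subseteq> V))"

definition S1_borel_omega :: "'a topology \<Rightarrow> bool" where
  "S1_borel_omega T \<longleftrightarrow>
     (\<forall>\<U> :: nat \<Rightarrow> 'a set set. (\<forall>n. borel_omega_cover T (\<U> n)) \<longrightarrow>
        (\<exists>V. (\<forall>n. V n \<in> \<U> n) \<and> borel_omega_cover T (range V)))"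

definition open_cover :: "'a topology \<Rightarrow> 'a set set \<Rightarrow> bool" where
  "open_cover T \<U> \<longleftrightarrow> (\<forall>V\<in>\<U>. openin T V) \<and> topspace T \<subseteq> \<Union>\<U>"

definition Menger_space :: "'a topology \<Rightarrow> bool" where
  "Menger_space T \<longleftrightarrow>
     (\<forall>\<U> :: nat \<Rightarrow> 'a set set. (\<forall>n. open_cover T (\<U> n)) \<longrightarrow>
        (\<exists>\<F>. (\<forall>n. finite (\<F> n) \<and> \<F> n \<subseteq> \<U> n) \<and> topspace T \<subseteq> \<Union>(\<Union>n. \<F> n)))"

end

(*
Enumerate the infinite sets as d_a, a < c, and choose by recursion x_a Cohen generic over everything
constructed before stage a, together with y_a, the set where x_a and d_a agree.  Agreement with a
fixed set is a homeomorphism, so y_a is generic as well.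

* Genericity makes {n. d_b(n) <= x_a(n)}, b <= a, a family with infinite finite intersections; any
  ultrafilter U containing it has b(U) = c, by regularity of c, and the x_a form a U-scale.
* The continuous map sending (x, y) to the set where x and y agree takes only infinite values on the
  products, and it attains every d_a: the products are not Menger.
* A sequence of Borel omega-covers is listed at some stage b.  Since cov(M) = c, one selection from
  it serves all finite sets of points constructed before stage b.  The invariant carried through the
  later stages is that for every finite set F of points and every finite set of cylinders some
  selected set contains F and is non-meager in each of these cylinders.
*)

theory Submission
  imports Defs
begin

section \<open>Meager sets and the Baire property\<close>

lemma nowhere_dense_in_subset:
  "nowhere_dense_in T B \<Longrightarrow> A \<subseteq> B \<Longrightarrow> nowhere_dense_in T A"
  unfolding nowhere_dense_in_def
  using interior_of_mono[OF closure_of_mono[of A B T], of T] by auto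

lemma nowhere_dense_in_frontier_of:
  assumes "openin T W"
  shows "nowhere_dense_in T (T frontier_of W)"
proof -
  have "V = {}" if V: "openin T V" "V \<subseteq> T closure_of W - W" for V
  proof -
    have "V \<inter> T closure_of W = {}"
      unfolding openin_Int_closure_of_eq_empty[OF V(1)] using V(2) by blast
    then show ?thesis
      using V(2) by blast
  qed
  then have "T interior_of (T frontier_of W) = {}"
    using assms by (simp add: interior_of_eq_empty frontier_of_openin)
  then show ?thesis
    by (simp add: nowhere_dense_in_def closure_of_closedin closedin_frontier_of frontier_of_subset_topspace)
qed

lemma nowhere_dense_in_singleton:
  assumes "closedin T {a}" "\<not> openin T {a}"
  shows "nowhere_dense_in T {a}"
proof -
  have "T interior_of {a} \<noteq> {a}"
    using assms(2) by (simp add: interior_of_eq)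
  then have "T interior_of {a} = {}"
    using interior_of_subset[of T "{a}"] by (simp add: subset_singleton_iff)
  then show ?thesis
    using assms(1) closedin_subset[OF assms(1)]
    by (simp add: nowhere_dense_in_def closure_of_closedin)
qed

lemma nowhere_dense_in_homeomorphic_image:
  assumes "homeomorphic_map T T' h" "nowhere_dense_in T A"
  shows "nowhere_dense_in T' (h ` A)"
proof -
  have A: "A \<subseteq> topspace T" "T interior_of (T closure_of A) = {}"
    using assms(2) by (simp_all add: nowhere_dense_in_def)
  have "T' interior_of (T' closure_of (h ` A)) = h ` (T interior_of (T closure_of A))"
    using assms(1) A(1)
    by (simp add: homeomorphic_map_closure_of homeomorphic_map_interior_of
        closure_of_subset_topspace)
  moreover have "h ` A \<subseteq> topspace T'"
    using A(1) homeomorphic_imp_surjective_map[OF assms(1)] by blast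
  ultimately show ?thesis
    using A(2) by (simp add: nowhere_dense_in_def)
qed

lemma nowhere_dense_in_dense_subtopology:
  assumes dense: "T closure_of S = topspace T" and A: "nowhere_dense_in T A"
  shows "nowhere_dense_in (subtopology T S) (S \<inter> A)"
proof -
  have "V \<inter> S = {}" if V: "openin T V" "V \<inter> S \<subseteq> subtopology T S closure_of (S \<inter> A)" for V
  proof -
    have "V \<inter> S \<subseteq> T closure_of A"
      using V(2) closure_of_subtopology_subset[of T S "S \<inter> A"] closure_of_mono[of "S \<inter> A" A T]
      by (meson Int_lower2 subset_trans)
    then have "T closure_of (V \<inter> S) \<subseteq> T closure_of A"
      by (simp add: closure_of_minimal)
    moreover have "V \<subseteq> T closure_of (V \<inter> S)"
      using openin_Int_closure_of_subset[OF V(1), of S] openin_subset[OF V(1)]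
      by (simp add: dense inf.absorb1)
    ultimately have "V \<subseteq> T interior_of (T closure_of A)"
      using V(1) by (intro interior_of_maximal) auto
    then show ?thesis
      using A by (simp add: nowhere_dense_in_def)
  qed
  then have "subtopology T S interior_of (subtopology T S closure_of (S \<inter> A)) = {}"
    unfolding interior_of_eq_empty openin_subtopology by blast
  then show ?thesis
    using A by (auto simp: nowhere_dense_in_def)
qed

lemma nowhere_dense_in_imp_meager_in: "nowhere_dense_in T A \<Longrightarrow> meager_in T A"
  unfolding meager_in_def by (intro exI[of _ "{A}"]) simp

lemma meager_in_empty [simp]: "meager_in T {}"
  unfolding meager_in_def by (intro exI[of _ "{}"]) simp

lemma meager_in_subset:
  assumes "meager_in T B" "A \<subseteq> B"
  shows "meager_in T A"
proof -
  obtain \<N> where \<N>: "countable \<N>" "\<And>N. N \<in> \<N> \<Longrightarrow> nowhere_dense_in T N" "B = \<Union>\<N>"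
    using assms(1) by (auto simp: meager_in_def)
  have "A = \<Union>((\<inter>) A ` \<N>)"
    using assms(2) \<N>(3) by blast
  moreover have "nowhere_dense_in T (A \<inter> N)" if "N \<in> \<N>" for N
    using \<N>(2)[OF that] by (rule nowhere_dense_in_subset) simp
  ultimately show ?thesis
    unfolding meager_in_def using \<N>(1) by (intro exI[of _ "(\<inter>) A ` \<N>"]) auto
qed

lemma meager_in_UNION:
  assumes "countable I" "\<And>i. i \<in> I \<Longrightarrow> meager_in T (A i)"
  shows "meager_in T (\<Union>i\<in>I. A i)"
proof -
  obtain \<N> where "\<And>i. i \<in> I \<Longrightarrow> countable (\<N> i) \<and> (\<forall>N\<in>\<N> i. nowhere_dense_in T N) \<and> A i = \<Union>(\<N> i)"
    using assms(2) unfolding meager_in_def by metis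
  then show ?thesis
    unfolding meager_in_def using assms(1) by (intro exI[of _ "\<Union>i\<in>I. \<N> i"]) auto
qed

lemma meager_in_Un: "meager_in T A \<Longrightarrow> meager_in T B \<Longrightarrow> meager_in T (A \<union> B)"
  using meager_in_UNION[of "{A, B}" T "\<lambda>A. A"] by auto

lemma meager_in_countable:
  assumes "countable A" "\<And>a. a \<in> A \<Longrightarrow> closedin T {a} \<and> \<not> openin T {a}"
  shows "meager_in T A"
proof -
  have "meager_in T (\<Union>a\<in>A. {a})"
    by (rule meager_in_UNION[OF assms(1)])
      (simp add: assms(2) nowhere_dense_in_imp_meager_in nowhere_dense_in_singleton)
  then show ?thesis by simp
qed

lemma meager_in_homeomorphic_image:
  assumes "homeomorphic_map T T' h" "meager_in T A"
  shows "meager_in T' (h ` A)"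
proof -
  obtain \<N> where \<N>: "countable \<N>" "\<And>N. N \<in> \<N> \<Longrightarrow> nowhere_dense_in T N" "A = \<Union>\<N>"
    using assms(2) by (auto simp: meager_in_def)
  have "meager_in T' (\<Union>N\<in>\<N>. h ` N)"
    using nowhere_dense_in_homeomorphic_image[OF assms(1) \<N>(2)]
    by (intro meager_in_UNION \<N>(1) nowhere_dense_in_imp_meager_in)
  then show ?thesis
    by (simp add: \<N>(3) image_Union)
qed

lemma meager_in_dense_subtopology:
  assumes "T closure_of S = topspace T" "meager_in T A"
  shows "meager_in (subtopology T S) (S \<inter> A)"
proof -
  obtain \<N> where \<N>: "countable \<N>" "\<And>N. N \<in> \<N> \<Longrightarrow> nowhere_dense_in T N" "A = \<Union>\<N>"
    using assms(2) by (auto simp: meager_in_def)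
  have "meager_in (subtopology T S) (\<Union>N\<in>\<N>. S \<inter> N)"
    using nowhere_dense_in_dense_subtopology[OF assms(1) \<N>(2)]
    by (intro meager_in_UNION \<N>(1) nowhere_dense_in_imp_meager_in)
  then show ?thesis
    by (simp only: \<N>(3) Int_Union)
qed

definition Baire_property_in :: "'a topology \<Rightarrow> 'a set \<Rightarrow> bool" where
  "Baire_property_in T V \<longleftrightarrow>
     V \<subseteq> topspace T \<and> (\<exists>W. openin T W \<and> meager_in T (V - W) \<and> meager_in T (W - V))"

lemma Baire_property_inE:
  assumes "Baire_property_in T V"
  obtains W where "openin T W" "meager_in T (V - W)" "meager_in T (W - V)"
  using assms by (auto simp: Baire_property_in_def)

lemma Baire_property_in_openin: "openin T W \<Longrightarrow> Baire_property_in T W"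
  unfolding Baire_property_in_def by (intro conjI exI[of _ W]) (simp_all add: openin_subset)

lemma Baire_property_in_Diff:
  assumes "Baire_property_in T V"
  shows "Baire_property_in T (topspace T - V)"
proof -
  obtain W where W: "openin T W" "meager_in T (V - W)" "meager_in T (W - V)"
    using assms by (rule Baire_property_inE)
  let ?W = "topspace T - T closure_of W"
  have sub: "W \<subseteq> T closure_of W"
    using W(1) by (simp add: closure_of_subset openin_subset)
  have "meager_in T (T frontier_of W \<union> (W - V))"
    using nowhere_dense_in_imp_meager_in[OF nowhere_dense_in_frontier_of[OF W(1)]] W(3)
    by (rule meager_in_Un)
  then have "meager_in T (topspace T - V - ?W)"
    by (rule meager_in_subset) (use frontier_of_openin[OF W(1)] in blast)
  moreover have "meager_in T (?W - (topspace T - V))"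
    using W(2) by (rule meager_in_subset) (use sub in blast)
  moreover have "openin T ?W"
    by (simp add: openin_diff)
  ultimately show ?thesis
    unfolding Baire_property_in_def by (intro conjI exI[of _ ?W] Diff_subset)
qed

lemma Baire_property_in_UNION:
  assumes "countable I" "\<And>i. i \<in> I \<Longrightarrow> Baire_property_in T (V i)"
  shows "Baire_property_in T (\<Union>i\<in>I. V i)"
proof -
  obtain W where W: "\<And>i. i \<in> I \<Longrightarrow> openin T (W i)"
    "\<And>i. i \<in> I \<Longrightarrow> meager_in T (V i - W i)" "\<And>i. i \<in> I \<Longrightarrow> meager_in T (W i - V i)"
    using assms(2) unfolding Baire_property_in_def by metis
  have "meager_in T ((\<Union>i\<in>I. V i) - (\<Union>i\<in>I. W i))"
    by (rule meager_in_subset[OF meager_in_UNION[OF assms(1) W(2)]]) auto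
  moreover have "meager_in T ((\<Union>i\<in>I. W i) - (\<Union>i\<in>I. V i))"
    by (rule meager_in_subset[OF meager_in_UNION[OF assms(1) W(3)]]) auto
  moreover have "openin T (\<Union>i\<in>I. W i)"
    using W(1) by auto
  moreover have "(\<Union>i\<in>I. V i) \<subseteq> topspace T"
    using assms(2) by (auto simp: Baire_property_in_def)
  ultimately show ?thesis
    unfolding Baire_property_in_def by (intro conjI exI[of _ "\<Union>i\<in>I. W i"])
qed

lemma Baire_property_in_borel_sets_of:
  assumes "V \<in> borel_sets_of T"
  shows "Baire_property_in T V"
  using assms[unfolded borel_sets_of_def]
proof (induction rule: sigma_sets.induct)
  case Empty
  show ?case by (rule Baire_property_in_openin) simp
qed (simp_all add: Baire_property_in_openin Baire_property_in_Diff Baire_property_in_UNION)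

lemma Baire_property_in_comeager:
  assumes V: "Baire_property_in T V"
    and nonmeager: "\<And>U. openin T U \<Longrightarrow> U \<noteq> {} \<Longrightarrow> \<not> meager_in T (V \<inter> U)"
  shows "meager_in T (topspace T - V)"
proof -
  obtain W where W: "openin T W" "meager_in T (V - W)" "meager_in T (W - V)"
    using V by (rule Baire_property_inE)
  have "W \<subseteq> T closure_of W"
    using W(1) by (simp add: closure_of_subset openin_subset)
  then have "meager_in T (V \<inter> (topspace T - T closure_of W))"
    by (intro meager_in_subset[OF W(2)]) blast
  then have "topspace T \<subseteq> T closure_of W"
    using nonmeager[of "topspace T - T closure_of W"] by (auto simp: openin_diff)
  then have "topspace T - V \<subseteq> T frontier_of W \<union> (W - V)"
    unfolding frontier_of_openin[OF W(1)] by blast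
  moreover have "meager_in T (T frontier_of W \<union> (W - V))"
    using nowhere_dense_in_imp_meager_in[OF nowhere_dense_in_frontier_of[OF W(1)]] W(3)
    by (rule meager_in_Un)
  ultimately show ?thesis
    using meager_in_subset by blast
qed

section \<open>Borel sets\<close>

lemma borel_sets_of_subtopology:
  assumes "S \<subseteq> topspace T"
  shows "borel_sets_of (subtopology T S) = (\<lambda>V. V \<inter> S) ` borel_sets_of T"
proof -
  have "(\<lambda>V. V \<inter> S) ` borel_sets_of T =
      {id -` V \<inter> S |V. V \<in> sigma_sets (topspace T) {V. openin T V}}"
    by (auto simp: borel_sets_of_def)
  also have "\<dots> = sigma_sets S {id -` V \<inter> S |V. V \<in> {V. openin T V}}"
    using assms by (intro sigma_sets_vimage_commute) auto
  also have "{id -` V \<inter> S |V. V \<in> {V. openin T V}} = {V. openin (subtopology T S) V}"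
    by (auto simp: openin_subtopology)
  also have "sigma_sets S {V. openin (subtopology T S) V} = borel_sets_of (subtopology T S)"
    using assms by (simp add: borel_sets_of_def inf.absorb2)
  finally show ?thesis ..
qed

lemma borel_sets_of_countable_base:
  assumes "countable \<B>" "\<And>U x. openin T U \<Longrightarrow> x \<in> U \<Longrightarrow> \<exists>V\<in>\<B>. x \<in> V \<and> V \<subseteq> U"
  shows "borel_sets_of T \<subseteq> sigma_sets (topspace T) \<B>"
  unfolding borel_sets_of_def
proof (rule sigma_sets_mono, rule subsetI)
  fix U assume "U \<in> {U. openin T U}"
  then have "U = \<Union>{V \<in> \<B>. V \<subseteq> U}"
    using assms(2) by blast
  moreover have "\<Union>{V \<in> \<B>. V \<subseteq> U} \<in> sigma_sets (topspace T) \<B>"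
    using assms(1) by (intro sigma_sets_UNION) (auto intro: sigma_sets.Basic countable_subset)
  ultimately show "U \<in> sigma_sets (topspace T) \<B>" by simp
qed

datatype sigma_code = Generator nat | Complement sigma_code | Countable_Union "nat \<Rightarrow> sigma_code"

primrec sigma_of_code :: "'a set \<Rightarrow> (nat \<Rightarrow> 'a set) \<Rightarrow> sigma_code \<Rightarrow> 'a set" where
  "sigma_of_code \<Omega> g (Generator n) = g n"
| "sigma_of_code \<Omega> g (Complement c) = \<Omega> - sigma_of_code \<Omega> g c"
| "sigma_of_code \<Omega> g (Countable_Union c) = (\<Union>n. sigma_of_code \<Omega> g (c n))"

lemma sigma_sets_subset_range_sigma_of_code:
  assumes "{} \<in> range g"
  shows "sigma_sets \<Omega> (range g) \<subseteq> range (sigma_of_code \<Omega> g)"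
proof
  fix V assume "V \<in> sigma_sets \<Omega> (range g)"
  then show "V \<in> range (sigma_of_code \<Omega> g)"
  proof (induction rule: sigma_sets.induct)
    case (Basic V)
    then obtain n where "V = sigma_of_code \<Omega> g (Generator n)" by auto
    then show ?case by blast
  next
    case Empty
    with assms obtain n where "{} = sigma_of_code \<Omega> g (Generator n)" by auto
    then show ?case by blast
  next
    case (Compl V)
    then obtain c where "\<Omega> - V = sigma_of_code \<Omega> g (Complement c)" by auto
    then show ?case by blast
  next
    case (Union V)
    then obtain c where "\<And>n. V n = sigma_of_code \<Omega> g (c n)"
      unfolding image_iff by metis
    then have "(\<Union>n. V n) = sigma_of_code \<Omega> g (Countable_Union c)" by simp
    then show ?case by blast
  qed
qed

text \<open>A code is a well-founded tree; it is determined by the labels of its nodes, the nodes being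
  addressed by paths from the root.\<close>

primrec node_label :: "sigma_code \<Rightarrow> nat list \<Rightarrow> nat" where
  "node_label (Generator n) = (\<lambda>_. n + 2)"
| "node_label (Complement c) = (\<lambda>p. case p of [] \<Rightarrow> 0 | _ # q \<Rightarrow> node_label c q)"
| "node_label (Countable_Union c) = (\<lambda>p. case p of [] \<Rightarrow> 1 | i # q \<Rightarrow> node_label (c i) q)"

lemma inj_node_label: "inj node_label"
proof (rule injI)
  show "c = d" if "node_label c = node_label d" for c d
    using that
  proof (induction c arbitrary: d)
    case (Generator n)
    from fun_cong[OF this, of "[]"] show ?case
      by (cases d) auto
  next
    case (Complement c)
    from fun_cong[OF Complement.prems, of "[]"] obtain d' where d: "d = Complement d'"
      by (cases d) auto
    have "node_label c q = node_label d' q" for q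
      using fun_cong[OF Complement.prems, of "0 # q"] by (simp add: d)
    then show ?case
      using Complement.IH d by blast
  next
    case (Countable_Union c)
    from fun_cong[OF Countable_Union.prems, of "[]"] obtain d' where d: "d = Countable_Union d'"
      by (cases d) auto
    have "node_label (c i) q = node_label (d' i) q" for i q
      using fun_cong[OF Countable_Union.prems, of "i # q"] by (simp add: d)
    then have "c i = d' i" for i
      using Countable_Union.IH by blast
    then show ?case
      by (auto simp: d)
  qed
qed

lemma continuum_ordIso_nat_sets: "continuum =o |UNIV :: nat set set|"
proof -
  have "continuum = |UNIV :: (nat \<Rightarrow> bool) set|"
    by (simp add: continuum_def cexp_def Func_def Field_natLeq ctwo_def Field_card_of)
  moreover have "bij_betw Collect (UNIV :: (nat \<Rightarrow> bool) set) UNIV"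
    by (rule bij_betw_byWitness[of _ "\<lambda>A n. n \<in> A"]) auto
  ultimately show ?thesis
    using card_of_ordIsoI by metis
qed

lemma card_countable_fun_le_continuum:
  "|UNIV :: ('a::countable \<Rightarrow> 'b::countable) set| \<le>o continuum"
proof -
  define graph :: "('a \<Rightarrow> 'b) \<Rightarrow> nat set" where "graph f = range (\<lambda>a. to_nat (a, f a))" for f
  have "inj graph"
  proof (rule injI, rule ext)
    fix f f' a assume "graph f = graph f'"
    then have "to_nat (a, f a) \<in> graph f'"
      unfolding graph_def by blast
    then show "f a = f' a"
      by (auto simp: graph_def)
  qed
  then have "|UNIV :: ('a \<Rightarrow> 'b) set| \<le>o |UNIV :: nat set set|"
    using card_of_ordLeq by blast
  then show ?thesis
    using ordLeq_ordIso_trans ordIso_symmetric continuum_ordIso_nat_sets by blast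
qed

lemma card_sigma_sets_le_continuum:
  assumes "countable G"
  shows "|sigma_sets \<Omega> G| \<le>o continuum"
proof -
  define g where "g = from_nat_into (insert {} G)"
  have g: "range g = insert {} G"
    unfolding g_def using assms by (intro range_from_nat_into) auto
  have "sigma_sets \<Omega> G \<subseteq> range (sigma_of_code \<Omega> g)"
    using sigma_sets_subset_range_sigma_of_code[of g \<Omega>] sigma_sets_mono'[of G "range g" \<Omega>] g
    by blast
  then have "|sigma_sets \<Omega> G| \<le>o |UNIV :: sigma_code set|"
    by (rule surj_imp_ordLeq)
  also have "|UNIV :: sigma_code set| \<le>o |UNIV :: (nat list \<Rightarrow> nat) set|"
    using inj_node_label card_of_ordLeq by blast
  also have "|UNIV :: (nat list \<Rightarrow> nat) set| \<le>o continuum"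
    by (rule card_countable_fun_le_continuum)
  finally show ?thesis .
qed

lemma card_borel_sets_of_le_continuum:
  assumes "second_countable T"
  shows "|borel_sets_of T| \<le>o continuum"
proof -
  obtain \<B> where \<B>: "countable \<B>" "\<And>U x. openin T U \<Longrightarrow> x \<in> U \<Longrightarrow> \<exists>V\<in>\<B>. x \<in> V \<and> V \<subseteq> U"
    using assms unfolding second_countable_def by metis
  have "|borel_sets_of T| \<le>o |sigma_sets (topspace T) \<B>|"
    using borel_sets_of_countable_base[OF \<B>] by (rule card_of_mono1)
  also have "|sigma_sets (topspace T) \<B>| \<le>o continuum"
    using \<B>(1) by (rule card_sigma_sets_le_continuum)
  finally show ?thesis .
qed

section \<open>The Cantor space\<close>

lemma topspace_cantor [simp]: "topspace cantor = UNIV"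
  by (simp add: cantor_def topspace_pullback_topology)

lemma continuous_map_cantor_iff:
  "continuous_map T cantor f \<longleftrightarrow> (\<forall>n. continuous_map T (discrete_topology UNIV) (\<lambda>t. n \<in> f t))"
proof
  assume f: "continuous_map T cantor f"
  have "continuous_map cantor (product_topology (\<lambda>_. discrete_topology UNIV) UNIV)
      ((\<lambda>g. g) \<circ> (\<lambda>A n. n \<in> A))"
    unfolding cantor_def by (intro continuous_map_pullback) simp
  then have "continuous_map cantor (discrete_topology UNIV) (\<lambda>A. n \<in> A)" for n :: nat
    by (simp add: continuous_map_componentwise_UNIV o_def)
  with f show "\<forall>n. continuous_map T (discrete_topology UNIV) (\<lambda>t. n \<in> f t)"
    using continuous_map_compose[of T cantor f] by (auto simp: o_def)
next
  assume "\<forall>n. continuous_map T (discrete_topology UNIV) (\<lambda>t. n \<in> f t)"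
  then show "continuous_map T cantor f"
    unfolding cantor_def
    by (intro continuous_map_pullback') (simp_all add: continuous_map_componentwise_UNIV o_def)
qed

lemma continuous_map_mem_cantor: "continuous_map cantor (discrete_topology UNIV) (\<lambda>x. n \<in> x)"
proof -
  have "continuous_map cantor cantor (\<lambda>x. x)" by simp
  then show ?thesis
    unfolding continuous_map_cantor_iff by blast
qed

definition cyl :: "nat set \<Rightarrow> nat \<Rightarrow> nat set set" where
  "cyl p m = {x. x \<inter> {..<m} = p \<inter> {..<m}}"

lemma mem_cyl_iff: "x \<in> cyl p m \<longleftrightarrow> (\<forall>n<m. n \<in> x \<longleftrightarrow> n \<in> p)"
  by (auto simp: cyl_def)

lemma mem_cyl_self [simp]: "p \<in> cyl p m"
  by (simp add: cyl_def)

lemma openin_cyl: "openin cantor (cyl p m)"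
proof (induction m)
  case 0
  then show ?case
    using openin_topspace[of cantor] by (simp add: cyl_def)
next
  case (Suc m)
  have "openin cantor {x \<in> topspace cantor. (m \<in> x) \<in> {m \<in> p}}"
    using continuous_map_mem_cantor by (rule openin_continuous_map_preimage) simp
  moreover have "cyl p (Suc m) = cyl p m \<inter> {x \<in> topspace cantor. (m \<in> x) \<in> {m \<in> p}}"
    by (auto simp: mem_cyl_iff less_Suc_eq)
  ultimately show ?case
    using Suc by (simp add: openin_Int)
qed

lemma cyl_subset_openin_cantor:
  assumes "openin cantor W" "x \<in> W"
  obtains m where "cyl x m \<subseteq> W"
proof -
  obtain G where G: "openin (product_topology (\<lambda>_. discrete_topology (UNIV :: bool set)) UNIV) G"
    and W: "W = (\<lambda>x n. n \<in> x) -` G"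
    using assms(1) by (auto simp: cantor_def openin_pullback_topology)
  then obtain V where V: "finite {n. V n \<noteq> UNIV}" "\<And>n. (n \<in> x) \<in> V n" "Pi\<^sub>E UNIV V \<subseteq> G"
    using assms(2) unfolding openin_product_topology_alt by (fastforce simp: PiE_def Pi_def)
  obtain m where m: "{n. V n \<noteq> UNIV} \<subseteq> {..<m}"
    using finite_nat_bounded[OF V(1)] by blast
  have "cyl x m \<subseteq> W"
  proof
    fix y assume "y \<in> cyl x m"
    then have "(n \<in> y) \<in> V n" for n
      using m V(2)[of n] by (cases "n < m") (auto simp: mem_cyl_iff)
    then have "(\<lambda>n. n \<in> y) \<in> Pi\<^sub>E UNIV V"
      by auto
    then show "y \<in> W"
      using V(3) by (auto simp: W)
  qed
  then show thesis by (rule that)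
qed

lemma openin_cantor_if_cyl: "(\<And>x. x \<in> W \<Longrightarrow> \<exists>m. cyl x m \<subseteq> W) \<Longrightarrow> openin cantor W"
  by (subst openin_subopen) (meson mem_cyl_self openin_cyl)

definition cylinders :: "nat set set set" where
  "cylinders = {cyl p m |p m. True}"

lemma countable_Fin: "countable Fin"
  unfolding Fin_def by (simp add: countable_Collect_finite)

lemma countable_cylinders: "countable cylinders"
proof -
  have "cyl p m \<in> (\<lambda>(p, m). cyl p m) ` (Fin \<times> UNIV)" for p m
    by (rule image_eqI[of _ _ "(p \<inter> {..<m}, m)"]) (auto simp: cyl_def Fin_def)
  then have "cylinders \<subseteq> (\<lambda>(p, m). cyl p m) ` (Fin \<times> UNIV)"
    unfolding cylinders_def by blast
  moreover have "countable ((\<lambda>(p, m). cyl p m) ` (Fin \<times> UNIV))"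
    by (intro countable_image countable_SIGMA countable_Fin) simp
  ultimately show ?thesis
    by (rule countable_subset)
qed

lemma openin_cantor_contains_cylinder:
  assumes "openin cantor W" "W \<noteq> {}"
  shows "\<exists>C\<in>cylinders. C \<subseteq> W"
proof -
  from assms(2) obtain x where "x \<in> W" by blast
  with assms(1) obtain m where "cyl x m \<subseteq> W"
    by (rule cyl_subset_openin_cantor)
  then show ?thesis
    by (auto simp: cylinders_def)
qed

lemma second_countable_cantor: "second_countable cantor"
  unfolding second_countable_def
proof (intro exI conjI allI impI)
  show "countable cylinders"
    by (rule countable_cylinders)
  show "\<forall>V\<in>cylinders. openin cantor V"
    by (auto simp: cylinders_def openin_cyl)
  fix W x assume "openin cantor W \<and> x \<in> W"
  then obtain m where "cyl x m \<subseteq> W"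
    using cyl_subset_openin_cantor by blast
  then show "\<exists>V\<in>cylinders. x \<in> V \<and> V \<subseteq> W"
    unfolding cylinders_def using mem_cyl_self by blast
qed

lemma nowhere_dense_in_cantorI:
  assumes "\<And>p m. \<exists>q\<in>cyl p m. \<exists>k. cyl q k \<inter> A = {}"
  shows "nowhere_dense_in cantor A"
proof -
  have "W = {}" if W: "openin cantor W" "W \<subseteq> cantor closure_of A" for W
  proof (rule ccontr)
    assume "W \<noteq> {}"
    then obtain p m where "cyl p m \<subseteq> W"
      using openin_cantor_contains_cylinder[OF W(1)] by (auto simp: cylinders_def)
    moreover obtain q k where q: "q \<in> cyl p m" "cyl q k \<inter> A = {}"
      using assms by blast
    ultimately have "q \<in> cyl q k \<inter> cantor closure_of A"
      using W(2) by auto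
    then show False
      using q(2) openin_Int_closure_of_eq_empty[OF openin_cyl] by blast
  qed
  then show ?thesis
    by (simp add: nowhere_dense_in_def interior_of_eq_empty)
qed

lemma meager_in_cantor_countable:
  assumes "countable A"
  shows "meager_in cantor A"
  using assms
proof (rule meager_in_countable)
  fix a :: "nat set"
  have "openin cantor (- {a})"
  proof (rule openin_cantor_if_cyl)
    fix x assume "x \<in> - {a}"
    then obtain n where "n \<in> x \<longleftrightarrow> n \<notin> a" by blast
    then have "cyl x (Suc n) \<subseteq> - {a}"
      by (auto simp: mem_cyl_iff)
    then show "\<exists>m. cyl x m \<subseteq> - {a}" ..
  qed
  moreover have "\<not> cyl a m \<subseteq> {a}" for m
  proof
    assume "cyl a m \<subseteq> {a}"
    moreover have "a \<inter> {..<m} \<in> cyl a m" "a \<union> {m..} \<in> cyl a m"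
      by (auto simp: mem_cyl_iff)
    ultimately have "a \<inter> {..<m} = a \<union> {m..}" by blast
    then show False by auto
  qed
  then have "\<not> openin cantor {a}"
    using cyl_subset_openin_cantor[of "{a}" a] by blast
  ultimately show "closedin cantor {a} \<and> \<not> openin cantor {a}"
    by (simp add: closedin_def Compl_eq_Diff_UNIV)
qed

lemma infsets_dense: "cantor closure_of infsets = topspace cantor"
proof -
  have "\<exists>y\<in>infsets. y \<in> W" if "x \<in> W" "openin cantor W" for x W
  proof -
    obtain m where "cyl x m \<subseteq> W"
      using \<open>openin cantor W\<close> \<open>x \<in> W\<close> by (rule cyl_subset_openin_cantor)
    moreover have "x \<union> {m..} \<in> cyl x m"
      by (auto simp: mem_cyl_iff)
    ultimately show ?thesis
      using infinite_Ici[of m] by (auto simp: infsets_def)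
  qed
  then show ?thesis
    by (auto simp: in_closure_of Bex_def)
qed

subsection \<open>Agreement sets\<close>

definition agree :: "nat set \<Rightarrow> nat set \<Rightarrow> nat set" where
  "agree x y = {n. n \<in> x \<longleftrightarrow> n \<in> y}"

lemma agree_agree [simp]: "agree x (agree x d) = d" "agree (agree x d) d = x"
  by (auto simp: agree_def)

lemma agree_commute: "agree x y = agree y x"
  by (auto simp: agree_def)

lemma agree_UNIV [simp]: "agree x UNIV = x"
  by (auto simp: agree_def)

lemma agree_mem_cyl_iff: "agree x d \<in> cyl p m \<longleftrightarrow> x \<in> cyl (agree p d) m"
  by (auto simp: agree_def mem_cyl_iff)

lemma agree_vimage_cylinder: "C \<in> cylinders \<Longrightarrow> (\<lambda>x. agree x d) -` C \<in> cylinders"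
  unfolding cylinders_def by (force simp: agree_mem_cyl_iff vimage_def)

lemma continuous_map_agree:
  "continuous_map (prod_topology cantor cantor) cantor (\<lambda>(x, y). agree x y)"
  unfolding continuous_map_cantor_iff
proof
  fix n
  let ?B = "discrete_topology (UNIV :: bool set)"
  have "continuous_map (prod_topology cantor cantor) (prod_topology ?B ?B)
      (\<lambda>z. (n \<in> fst z, n \<in> snd z))"
    using continuous_map_compose[OF continuous_map_fst continuous_map_mem_cantor]
      continuous_map_compose[OF continuous_map_snd continuous_map_mem_cantor]
    by (intro continuous_map_pairedI) (simp_all add: o_def)
  moreover have "continuous_map (prod_topology ?B ?B) ?B (\<lambda>(b, c). b \<longleftrightarrow> c)"
    by (simp flip: prod_topology_discrete_topology)
  ultimately have "continuous_map (prod_topology cantor cantor) ?B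
      ((\<lambda>(b, c). b \<longleftrightarrow> c) \<circ> (\<lambda>z. (n \<in> fst z, n \<in> snd z)))"
    by (rule continuous_map_compose)
  then show "continuous_map (prod_topology cantor cantor) ?B
      (\<lambda>z. n \<in> (case z of (x, y) \<Rightarrow> agree x y))"
    by (simp add: o_def agree_def case_prod_beta)
qed

lemma homeomorphic_map_agree: "homeomorphic_map cantor cantor (\<lambda>x. agree x d)"
proof -
  have "continuous_map cantor cantor ((\<lambda>(x, y). agree x y) \<circ> (\<lambda>x. (x, d)))"
    using continuous_map_agree by (intro continuous_map_compose[of _ "prod_topology cantor cantor"])
      (simp_all add: continuous_map_pairedI)
  then have "continuous_map cantor cantor (\<lambda>x. agree x d)"
    by (simp add: o_def)
  then have "homeomorphic_maps cantor cantor (\<lambda>x. agree x d) (\<lambda>x. agree x d)"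
    by (simp add: homeomorphic_maps_def)
  then show ?thesis
    by (rule homeomorphic_maps_imp_map)
qed

section \<open>Menger spaces\<close>

lemma enumerate_less_iff:
  fixes a :: "nat set"
  assumes "infinite a"
  shows "enumerate a n < m \<longleftrightarrow> n < card (a \<inter> {..<m})"
proof -
  let ?I = "{i. enumerate a i < m}"
  have "enumerate a ` ?I = a \<inter> {..<m}"
    using bij_enumerate[OF assms] by (auto simp: bij_betw_def)
  moreover have "inj_on (enumerate a) ?I"
    using inj_enumerate[OF assms] by (rule inj_on_subset) simp
  ultimately have card: "card (a \<inter> {..<m}) = card ?I"
    using card_image by fastforce
  have fin: "finite ?I"
    using le_enumerate[OF assms]
    by (intro finite_subset[of ?I "{..<m}"]) (auto intro: le_less_trans)
  show ?thesis
  proof (cases "enumerate a n < m")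
    case True
    then have "{..n} \<subseteq> ?I"
      using assms by (auto intro: le_less_trans[of _ "enumerate a n"])
    then have "card {..n} \<le> card ?I"
      by (rule card_mono[OF fin])
    with True show ?thesis
      by (simp add: card)
  next
    case False
    have "?I \<subseteq> {..<n}"
    proof
      fix i assume "i \<in> ?I"
      with False have "enumerate a i < enumerate a n" by simp
      then show "i \<in> {..<n}"
        using assms by simp
    qed
    then have "card ?I \<le> card {..<n}"
      by (intro card_mono) simp_all
    with False show ?thesis
      by (simp add: card)
  qed
qed

lemma infinite_set_with_large_enumeration:
  fixes g :: "nat \<Rightarrow> nat"
  obtains d :: "nat set" where "infinite d" "\<And>n. g n \<le> enumerate d n"
proof -
  define e where "e n = n + (\<Sum>i\<le>n. g i)" for n
  have e: "strict_mono e"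
    by (rule strict_monoI_Suc) (simp add: e_def)
  then have inf: "infinite (range e)"
    using range_inj_infinite strict_mono_imp_inj_on by blast
  have "g n \<le> enumerate (range e) n" for n
  proof -
    have "\<exists>k. enumerate (range e) n = e k" for n
      using enumerate_in_set[OF inf] by blast
    then obtain r where r: "\<And>n. enumerate (range e) n = e (r n)"
      by metis
    have "strict_mono r"
    proof (rule strict_monoI)
      fix i j :: nat assume "i < j"
      then have "e (r i) < e (r j)"
        unfolding r[symmetric] using inf by (rule enumerate_mono)
      then show "r i < r j"
        using e by (simp add: strict_mono_less)
    qed
    then have "n \<le> r n"
      by (rule strict_mono_imp_increasing)
    then have "e n \<le> e (r n)"
      using e by (simp add: strict_mono_less_eq)
    moreover have "g n \<le> e n"
      unfolding e_def by (rule trans_le_add2) (rule member_le_sum, auto)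
    ultimately show ?thesis
      by (simp add: r)
  qed
  with inf show thesis by (rule that)
qed

lemma Menger_space_imp_bounded:
  fixes h :: "'a \<Rightarrow> nat \<Rightarrow> nat"
  assumes "Menger_space T" and "\<And>n m. openin T {t \<in> topspace T. h t n < m}"
  obtains g where "\<And>t. t \<in> topspace T \<Longrightarrow> \<exists>n. h t n < g n"
proof -
  define W where "W n m = {t \<in> topspace T. h t n < m}" for n m
  have "topspace T \<subseteq> \<Union>(range (W n))" for n
    by (auto simp: W_def)
  then have "\<forall>n. open_cover T (range (W n))"
    using assms(2) by (auto simp: open_cover_def W_def)
  then obtain \<F> where \<F>: "\<And>n. finite (\<F> n)" "\<And>n. \<F> n \<subseteq> range (W n)" "topspace T \<subseteq> \<Union>(\<Union>n. \<F> n)"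
    using assms(1) unfolding Menger_space_def by meson
  have "\<exists>g. \<Union>(\<F> n) \<subseteq> W n g" for n
  proof -
    obtain M where M: "finite M" "\<F> n = W n ` M"
      using finite_subset_image[OF \<F>(1,2)] by blast
    have "W n m \<subseteq> W n (Max M)" if "m \<in> M" for m
      using Max_ge[OF M(1) that] by (auto simp: W_def)
    then have "\<Union>(\<F> n) \<subseteq> W n (Max M)"
      unfolding M(2) by blast
    then show ?thesis ..
  qed
  then obtain g where g: "\<And>n. \<Union>(\<F> n) \<subseteq> W n (g n)"
    by metis
  show thesis
  proof (rule that)
    fix t assume "t \<in> topspace T"
    then obtain n where "t \<in> W n (g n)"
      using \<F>(3) g by blast
    then show "\<exists>n. h t n < g n"
      by (auto simp: W_def)
  qed
qed

lemma openin_enumerate_less: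
  assumes f: "continuous_map T cantor f" "f ` topspace T \<subseteq> infsets"
  shows "openin T {t \<in> topspace T. enumerate (f t) n < m}"
proof -
  have "openin cantor {a. n < card (a \<inter> {..<m})}"
  proof (rule openin_cantor_if_cyl)
    fix x assume "x \<in> {a. n < card (a \<inter> {..<m})}"
    then have "cyl x m \<subseteq> {a. n < card (a \<inter> {..<m})}"
      by (simp add: cyl_def subset_iff)
    then show "\<exists>m'. cyl x m' \<subseteq> {a. n < card (a \<inter> {..<m})}" ..
  qed
  then have "openin T {t \<in> topspace T. f t \<in> {a. n < card (a \<inter> {..<m})}}"
    by (rule openin_continuous_map_preimage[OF f(1)])
  also have "{t \<in> topspace T. f t \<in> {a. n < card (a \<inter> {..<m})}} =
      {t \<in> topspace T. enumerate (f t) n < m}"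
    using f(2) by (intro Collect_cong conj_cong refl)
      (simp add: enumerate_less_iff infsets_def image_subset_iff)
  finally show ?thesis .
qed

lemma not_Menger_space_if_onto_infsets:
  assumes f: "continuous_map T cantor f" "f ` topspace T = infsets"
  shows "\<not> Menger_space T"
proof
  have "openin T {t \<in> topspace T. enumerate (f t) n < m}" for n m
    using f by (intro openin_enumerate_less) simp_all
  moreover assume "Menger_space T"
  ultimately obtain g where g: "\<And>t. t \<in> topspace T \<Longrightarrow> \<exists>n. enumerate (f t) n < g n"
    using Menger_space_imp_bounded[of T "\<lambda>t. enumerate (f t)"] by blast
  obtain d where d: "infinite d" "\<And>n. g n \<le> enumerate d n"
    using infinite_set_with_large_enumeration by blast
  then have "d \<in> f ` topspace T"
    by (simp add: f(2) infsets_def)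
  then obtain t where "t \<in> topspace T" "f t = d" by blast
  then show False
    using g[of t] d(2) leD by blast
qed

lemma not_Menger_space_prod:
  assumes "(\<lambda>(x, y). agree x y) ` (X \<times> Y) = infsets"
  shows "\<not> Menger_space (prod_topology (subtopology cantor X) (subtopology cantor Y))"
proof (rule not_Menger_space_if_onto_infsets)
  show "continuous_map (prod_topology (subtopology cantor X) (subtopology cantor Y)) cantor
      (\<lambda>(x, y). agree x y)"
    unfolding subtopology_Times[symmetric] using continuous_map_agree
    by (rule continuous_map_from_subtopology)
qed (simp add: assms)

section \<open>Ordinals below the continuum\<close>

lemma Cinfinite_continuum: "Cinfinite continuum"
  unfolding continuum_def
  by (intro Cinfinite_cexp natLeq_Cinfinite ordLeq_refl Card_order_ctwo)

definition small :: "'a set \<Rightarrow> bool" where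
  "small A \<longleftrightarrow> |A| <o continuum"

lemma small_subset: "small B \<Longrightarrow> A \<subseteq> B \<Longrightarrow> small A"
  unfolding small_def by (meson card_of_mono1 ordLeq_ordLess_trans)

lemma small_image: "small A \<Longrightarrow> small (f ` A)"
  unfolding small_def by (meson card_of_image ordLeq_ordLess_trans)

lemma small_countable:
  assumes "countable A"
  shows "small A"
proof -
  have "|A| \<le>o |UNIV :: nat set|"
    using assms card_of_ordLeq unfolding countable_def by blast
  also have "|UNIV :: nat set| <o |UNIV :: nat set set|"
    using card_of_Pow[of "UNIV :: nat set"] by simp
  also have "|UNIV :: nat set set| =o continuum"
    using continuum_ordIso_nat_sets by (rule ordIso_symmetric)
  finally show ?thesis
    unfolding small_def .
qed

lemma small_Un: "small A \<Longrightarrow> small B \<Longrightarrow> small (A \<union> B)"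
  using Cinfinite_continuum card_of_Un_ordLess_infinite_Field
  unfolding small_def cinfinite_def by blast

text \<open>In the cardinal library \<open>|A|\<close> is a well-order of \<open>A\<close> of least order type, so the following
  type consists of the ordinals below the continuum.\<close>

typedef cont_ord = "UNIV :: nat set set" ..

instantiation cont_ord :: linorder
begin

definition less_eq_cont_ord :: "cont_ord \<Rightarrow> cont_ord \<Rightarrow> bool" where
  "a \<le> b \<longleftrightarrow> (Rep_cont_ord a, Rep_cont_ord b) \<in> |UNIV :: nat set set|"

definition less_cont_ord :: "cont_ord \<Rightarrow> cont_ord \<Rightarrow> bool" where
  "(a :: cont_ord) < b \<longleftrightarrow> a \<le> b \<and> a \<noteq> b"

instance
proof
  let ?r = "|UNIV :: nat set set|"
  have order_properties: "refl ?r" "trans ?r" "antisym ?r" "total ?r"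
    using card_of_Well_order[of "UNIV :: nat set set"]
    by (simp_all add: well_order_on_def linear_order_on_def partial_order_on_def preorder_on_def
        Field_card_of)
  fix a b c :: cont_ord
  show "a \<le> a"
    using order_properties(1) by (simp add: less_eq_cont_ord_def refl_on_def)
  show "a \<le> b \<Longrightarrow> b \<le> c \<Longrightarrow> a \<le> c"
    using order_properties(2) unfolding less_eq_cont_ord_def by (rule transD)
  show antisym: "a \<le> b \<Longrightarrow> b \<le> a \<Longrightarrow> a = b"
    using order_properties(3)
    by (auto simp: less_eq_cont_ord_def Rep_cont_ord_inject dest: antisymD)
  then show "a < b \<longleftrightarrow> a \<le> b \<and> \<not> b \<le> a"
    using \<open>a \<le> a\<close> by (auto simp: less_cont_ord_def)
  show "a \<le> b \<or> b \<le> a"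
    using order_properties(4) \<open>a \<le> a\<close>
    by (cases "a = b") (auto simp: less_eq_cont_ord_def total_on_def Rep_cont_ord_inject)
qed

end

instance cont_ord :: wellorder
proof (rule wf_wellorderI)
  have "wf ( |UNIV :: nat set set| - Id)"
    using card_of_Well_order[of "UNIV :: nat set set"] by (simp add: well_order_on_def)
  then have "wf (inv_image ( |UNIV :: nat set set| - Id) Rep_cont_ord)"
    by (rule wf_inv_image)
  moreover have "inv_image ( |UNIV :: nat set set| - Id) Rep_cont_ord = {(a, b). a < b}"
    by (auto simp: less_cont_ord_def less_eq_cont_ord_def Rep_cont_ord_inject)
  ultimately show "wf {(a, b :: cont_ord). a < b}"
    by simp
qed standard

lemma card_cont_ord: "|UNIV :: cont_ord set| =o continuum"
proof -
  have "bij Rep_cont_ord"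
    by (rule bijI') (simp_all add: Rep_cont_ord_inject, metis Abs_cont_ord_inverse UNIV_I)
  then show ?thesis
    using card_of_ordIsoI ordIso_transitive ordIso_symmetric continuum_ordIso_nat_sets by metis
qed

lemma not_small_cont_ord: "\<not> small (UNIV :: cont_ord set)"
  using card_cont_ord not_ordLess_ordIso unfolding small_def by blast

lemma small_lessThan_cont_ord: "small {..<a :: cont_ord}"
proof -
  let ?r = "|UNIV :: nat set set|"
  have "Rep_cont_ord ` {..<a} \<subseteq> underS ?r (Rep_cont_ord a)"
    by (auto simp: less_cont_ord_def less_eq_cont_ord_def underS_def Rep_cont_ord_inject)
  moreover have "inj_on Rep_cont_ord {..<a}"
    by (simp add: inj_on_def Rep_cont_ord_inject)
  ultimately have "|{..<a}| \<le>o |underS ?r (Rep_cont_ord a)|"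
    using card_of_ordLeq by blast
  also have "|underS ?r (Rep_cont_ord a)| <o ?r"
    by (rule card_of_underS[OF card_of_Card_order]) (simp add: Field_card_of)
  also have "?r =o continuum"
    using continuum_ordIso_nat_sets by (rule ordIso_symmetric)
  finally show ?thesis
    unfolding small_def .
qed

lemma small_atMost_cont_ord: "small {..a :: cont_ord}"
proof -
  have "{..a} = {a} \<union> {..<a}" by auto
  then show ?thesis
    by (simp only: small_Un small_lessThan_cont_ord small_countable countable_insert
        countable_empty)
qed

lemma cofinal_tagging:
  assumes "countable C" "C \<noteq> {}"
  obtains tag :: "cont_ord \<Rightarrow> 'a" where "\<And>a. tag a \<in> C" "\<And>c b. c \<in> C \<Longrightarrow> \<exists>a\<ge>b. tag a = c"
proof -
  have inf: "infinite (UNIV :: cont_ord set)"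
    using not_small_cont_ord small_countable countable_finite by blast
  have "|C| <o |UNIV :: cont_ord set|"
    using small_countable[OF assms(1)] ordIso_symmetric[OF card_cont_ord] ordLess_ordIso_trans
    unfolding small_def by blast
  then have "|UNIV :: cont_ord set| =o |(UNIV :: cont_ord set) \<times> C|"
    using inf assms(2) ordLess_imp_ordLeq by (intro card_of_Times_infinite_simps(2))
  then obtain g where g: "bij_betw g (UNIV :: cont_ord set) ((UNIV :: cont_ord set) \<times> C)"
    using card_of_ordIso by blast
  have "\<exists>a\<ge>b. snd (g a) = c" if "c \<in> C" for b c
  proof (rule ccontr)
    assume "\<not> (\<exists>a\<ge>b. snd (g a) = c)"
    then have "{a. snd (g a) = c} \<subseteq> {..<b}"
      using not_less by blast
    then have "small ((fst \<circ> g) ` {a. snd (g a) = c})"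
      using small_lessThan_cont_ord small_subset by (intro small_image) blast
    moreover have "a \<in> (fst \<circ> g) ` {a. snd (g a) = c}" for a
    proof -
      have "(a, c) \<in> g ` UNIV"
        using g that by (simp add: bij_betw_def)
      then obtain e where "(a, c) = g e" by blast
      then show ?thesis
        by (intro image_eqI[of _ _ e]) (simp_all flip: \<open>(a, c) = g e\<close>)
    qed
    then have "(fst \<circ> g) ` {a. snd (g a) = c} = UNIV"
      by blast
    ultimately show False
      using not_small_cont_ord by simp
  qed
  moreover have "snd (g a) \<in> C" for a
    using bij_betwE[OF g] by (metis UNIV_I mem_Times_iff)
  ultimately show thesis
    by (intro that[of "\<lambda>a. snd (g a)"])
qed

lemma enumeration_of_infsets:
  obtains d :: "cont_ord \<Rightarrow> nat set" where "range d = infsets"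
proof -
  let ?d = "\<lambda>a. if infinite (Rep_cont_ord a) then Rep_cont_ord a else UNIV"
  have "a \<in> range ?d" if "infinite a" for a
    using that by (intro image_eqI[of _ _ "Abs_cont_ord a"]) (simp_all add: Abs_cont_ord_inverse)
  then have "range ?d = infsets"
    by (auto simp: infsets_def)
  then show thesis by (rule that)
qed

definition countable_borel_families :: "'a topology \<Rightarrow> 'a set set set" where
  "countable_borel_families T = {\<V>. countable \<V> \<and> \<V> \<noteq> {} \<and> \<V> \<subseteq> borel_sets_of T}"

lemma cont_ord_families_surj: "\<exists>e :: cont_ord \<Rightarrow> 'i::countable \<Rightarrow> cont_ord. surj e"
proof -
  define e :: "cont_ord \<Rightarrow> 'i \<Rightarrow> cont_ord"
    where "e a i = Abs_cont_ord {k. to_nat (i, k) \<in> Rep_cont_ord a}" for a i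
  have "e (Abs_cont_ord {to_nat (i, k) |i k. k \<in> Rep_cont_ord (c i)}) = c" for c
    by (simp add: e_def fun_eq_iff Abs_cont_ord_inverse Rep_cont_ord_inverse)
  then have "surj e"
    by (rule surjI)
  then show ?thesis by blast
qed

lemma enumeration_of_borel_family_sequences:
  assumes "second_countable T"
  obtains \<B> :: "cont_ord \<Rightarrow> nat \<Rightarrow> 'a set set"
    where "range \<B> = {\<V>. \<forall>n. \<V> n \<in> countable_borel_families T}"
proof -
  have "{} \<in> borel_sets_of T"
    by (simp add: borel_sets_of_def sigma_sets.Empty)
  moreover have "|borel_sets_of T| \<le>o |UNIV :: cont_ord set|"
    using card_borel_sets_of_le_continuum[OF assms] ordIso_symmetric[OF card_cont_ord]
    by (rule ordLeq_ordIso_trans)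
  ultimately obtain g where g: "g ` (UNIV :: cont_ord set) = borel_sets_of T"
    using card_of_ordLeq2[of "borel_sets_of T" "UNIV :: cont_ord set"] by blast
  obtain e :: "cont_ord \<Rightarrow> nat \<times> nat \<Rightarrow> cont_ord" where "surj e"
    using cont_ord_families_surj by blast
  define \<B> where "\<B> a n = range (\<lambda>i. g (e a (n, i)))" for a n
  have "\<V> \<in> range \<B>" if "\<And>n. \<V> n \<in> countable_borel_families T" for \<V>
  proof -
    have \<V>: "countable (\<V> n)" "\<V> n \<noteq> {}" "\<V> n \<subseteq> range g" for n
      using that[of n] g by (auto simp: countable_borel_families_def)
    have "\<exists>c. from_nat_into (\<V> n) i = g c" for n i
      using \<V>(3) from_nat_into[OF \<V>(2)] by blast
    then obtain c where c: "\<And>n i. from_nat_into (\<V> n) i = g (c n i)"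
      by metis
    obtain a where "e a = (\<lambda>(n, i). c n i)"
      using \<open>surj e\<close> by (metis surjD)
    then have "\<B> a n = \<V> n" for n
      using range_from_nat_into[OF \<V>(2,1), of n] by (simp add: \<B>_def flip: c)
    then have "\<B> a = \<V>" by blast
    then show ?thesis by blast
  qed
  moreover have "\<B> a n \<in> countable_borel_families T" for a n
    using g by (auto simp: \<B>_def countable_borel_families_def)
  ultimately have "range \<B> = {\<V>. \<forall>n. \<V> n \<in> countable_borel_families T}"
    by blast
  then show thesis by (rule that)
qed

section \<open>Generic reals\<close>

definition generically :: "(nat set \<Rightarrow> bool) \<Rightarrow> bool" where
  "generically P \<longleftrightarrow> (\<exists>\<M>. small \<M> \<and> (\<forall>M\<in>\<M>. meager_in cantor M) \<and> {x. \<not> P x} \<subseteq> \<Union>\<M>)"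

lemma generically_comeager: "meager_in cantor {x. \<not> P x} \<Longrightarrow> generically P"
  unfolding generically_def by (intro exI[of _ "{{x. \<not> P x}}"]) (auto simp: small_countable)

lemma generically_imp: "(Q \<Longrightarrow> generically P) \<Longrightarrow> generically (\<lambda>x. Q \<longrightarrow> P x)"
  by (cases Q) (simp_all add: generically_comeager)

lemma generically_mono:
  assumes "generically P" "\<And>x. P x \<Longrightarrow> Q x"
  shows "generically Q"
proof -
  have "{x. \<not> Q x} \<subseteq> {x. \<not> P x}"
    using assms(2) by blast
  then show ?thesis
    using assms(1) unfolding generically_def by (meson subset_trans)
qed

lemma generically_agree:
  assumes "generically P"
  shows "generically (\<lambda>x. P (agree x d))"
proof -
  let ?h = "\<lambda>x. agree x d"
  obtain \<M> where \<M>: "small \<M>" "\<And>M. M \<in> \<M> \<Longrightarrow> meager_in cantor M" "{x. \<not> P x} \<subseteq> \<Union>\<M>"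
    using assms by (auto simp: generically_def)
  have "small ((`) ?h ` \<M>)"
    by (intro small_image \<M>(1))
  moreover have "\<forall>M\<in>(`) ?h ` \<M>. meager_in cantor M"
    using meager_in_homeomorphic_image[OF homeomorphic_map_agree \<M>(2)] by blast
  moreover have "{x. \<not> P (?h x)} \<subseteq> \<Union>((`) ?h ` \<M>)"
  proof
    fix x assume "x \<in> {x. \<not> P (?h x)}"
    then obtain M where "M \<in> \<M>" "?h x \<in> M"
      using \<M>(3) by blast
    then show "x \<in> \<Union>((`) ?h ` \<M>)"
      by (intro UnionI[of "?h ` M"] image_eqI[of _ _ "?h x"]) simp_all
  qed
  ultimately show ?thesis
    unfolding generically_def by blast
qed

lemma generically_infinite_agree: "generically (\<lambda>x. infinite (agree x w))"
proof (rule generically_comeager, rule meager_in_cantor_countable)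
  have "x \<in> (\<lambda>F. agree F w) ` Fin" if "finite (agree x w)" for x
    using that by (intro image_eqI[of _ _ "agree x w"]) (simp_all add: Fin_def)
  then have "{x. \<not> infinite (agree x w)} \<subseteq> (\<lambda>F. agree F w) ` Fin"
    by blast
  then show "countable {x. \<not> infinite (agree x w)}"
    using countable_image[OF countable_Fin] by (rule countable_subset)
qed

definition selector :: "nat set \<Rightarrow> nat \<Rightarrow> nat" where
  "selector x n = (LEAST i. prod_encode (n, i) \<in> x)"

lemma cyl_subset_selector_eq: "\<exists>q\<in>cyl p m. \<exists>k. \<forall>x\<in>cyl q k. selector x m = i"
proof -
  obtain k where k: "(\<lambda>j. prod_encode (m, j)) ` {..i} \<subseteq> {..<k}"
    using finite_nat_bounded by (metis finite_atMost finite_imageI)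
  let ?q = "(p \<inter> {..<m}) \<union> {prod_encode (m, i)}"
  have ge: "m \<le> prod_encode (m, j)" for j
    by (rule le_prod_encode_1)
  have "selector x m = i" if x: "x \<in> cyl ?q k" for x
    unfolding selector_def
  proof (rule Least_equality)
    show "prod_encode (m, i) \<in> x"
      using x k by (auto simp: mem_cyl_iff)
  next
    fix j assume j: "prod_encode (m, j) \<in> x"
    show "i \<le> j"
    proof (rule ccontr)
      assume "\<not> i \<le> j"
      then have "prod_encode (m, j) < k"
        using k by (simp add: image_subset_iff)
      then have "prod_encode (m, j) \<in> ?q"
        using j x by (auto simp: mem_cyl_iff)
      with \<open>\<not> i \<le> j\<close> ge[of j] show False by auto
    qed
  qed
  moreover have "?q \<in> cyl p m"
    using ge[of i] by (auto simp: mem_cyl_iff)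
  ultimately show ?thesis by blast
qed

lemma generically_selector:
  assumes "\<And>n. \<exists>i. Q n i"
  shows "generically (\<lambda>x. \<exists>n. Q n (selector x n))"
proof (rule generically_comeager[OF nowhere_dense_in_imp_meager_in[OF nowhere_dense_in_cantorI]])
  fix p m
  obtain i where i: "Q m i"
    using assms by blast
  obtain q k where "q \<in> cyl p m" "\<And>x. x \<in> cyl q k \<Longrightarrow> selector x m = i"
    using cyl_subset_selector_eq by meson
  with i show "\<exists>q\<in>cyl p m. \<exists>k. cyl q k \<inter> {x. \<not> (\<exists>n. Q n (selector x n))} = {}"
    by (intro bexI[of _ q] exI[of _ k]) auto
qed

locale regular_continuum =
  assumes regularCard_continuum: "regularCard continuum"
begin

lemma small_UNION:
  assumes "small I" "\<And>i. i \<in> I \<Longrightarrow> small (A i)"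
  shows "small (\<Union>i\<in>I. A i)"
  using regularCard_UNION_bound[OF Cinfinite_continuum regularCard_continuum] assms
  unfolding small_def by blast

lemma small_Fpow:
  assumes "small A"
  shows "small (Fpow A)"
proof -
  have "small {F. F \<subseteq> A \<and> finite F \<and> card F = n}" for n
  proof (induction n)
    case 0
    have "{F. F \<subseteq> A \<and> finite F \<and> card F = 0} \<subseteq> {{}}" by auto
    then show ?case
      by (rule small_subset[rotated]) (simp add: small_countable)
  next
    case (Suc n)
    have "small (\<Union>a\<in>A. insert a ` {F. F \<subseteq> A \<and> finite F \<and> card F = n})"
      by (intro small_UNION assms small_image Suc)
    then show ?case
      by (rule small_subset) (auto simp: card_Suc_eq_finite)
  qed
  then have "small (\<Union>n. {F. F \<subseteq> A \<and> finite F \<and> card F = n})"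
    by (intro small_UNION[OF small_countable]) simp_all
  then show ?thesis
    by (rule small_subset) (auto simp: Fpow_def)
qed

lemma small_bounded_cont_ord:
  fixes K :: "cont_ord set"
  assumes "small K"
  obtains a where "K \<subseteq> {..a}"
proof -
  have "small (\<Union>b\<in>K. {..b})"
    using assms small_atMost_cont_ord by (rule small_UNION)
  then have "(\<Union>b\<in>K. {..b}) \<noteq> UNIV"
    using not_small_cont_ord by auto
  then obtain a where "\<And>b. b \<in> K \<Longrightarrow> \<not> a \<le> b"
    by auto
  then have "K \<subseteq> {..a}"
    using le_cases by blast
  then show thesis by (rule that)
qed

lemma generically_ball:
  assumes "small I" "\<And>i. i \<in> I \<Longrightarrow> generically (P i)"
  shows "generically (\<lambda>x. \<forall>i\<in>I. P i x)"
proof -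
  have "\<forall>i\<in>I. \<exists>\<M>. small \<M> \<and> (\<forall>M\<in>\<M>. meager_in cantor M) \<and> {x. \<not> P i x} \<subseteq> \<Union>\<M>"
    using assms(2) by (simp add: generically_def)
  from bchoice[OF this] obtain \<M> where
    \<M>: "\<forall>i\<in>I. small (\<M> i) \<and> (\<forall>M\<in>\<M> i. meager_in cantor M) \<and> {x. \<not> P i x} \<subseteq> \<Union>(\<M> i)" ..
  have "small (\<Union>i\<in>I. \<M> i)"
    using assms(1) \<M> by (intro small_UNION) auto
  moreover have "{x. \<not> (\<forall>i\<in>I. P i x)} \<subseteq> \<Union>(\<Union>i\<in>I. \<M> i)"
    using \<M> by fastforce
  ultimately show ?thesis
    unfolding generically_def using \<M> by (intro exI[of _ "\<Union>i\<in>I. \<M> i"]) auto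
qed

lemma generically_all:
  fixes P :: "'i::countable \<Rightarrow> nat set \<Rightarrow> bool"
  assumes "\<And>i. generically (P i)"
  shows "generically (\<lambda>x. \<forall>i. P i x)"
  using generically_ball[of UNIV P] assms by (simp add: small_countable)

lemma generically_conj:
  assumes "generically P" "generically Q"
  shows "generically (\<lambda>x. P x \<and> Q x)"
  using generically_all[of "\<lambda>b. if b then P else Q"] assms by (simp add: all_bool_eq)

lemma generically_enumerate_ge:
  assumes "infinite C"
  shows "generically (\<lambda>x. infinite {n \<in> C. g n \<le> enumerate x n})"
proof -
  have "generically (\<lambda>x. infinite x \<longrightarrow> (\<exists>n\<in>C. N \<le> n \<and> g n \<le> enumerate x n))" for N
  proof (rule generically_comeager[OF nowhere_dense_in_imp_meager_in[OF nowhere_dense_in_cantorI]])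
    fix p m
    obtain n where n: "n \<in> C" "N \<le> n" "m \<le> n"
      using assms infinite_nat_iff_unbounded_le by (metis max.bounded_iff)
    let ?q = "p \<inter> {..<m}"
    have "g n \<le> enumerate x n" if "infinite x" "x \<in> cyl ?q (g n)" for x
    proof -
      have "x \<inter> {..<g n} \<subseteq> {..<m}"
        using that(2) by (auto simp: mem_cyl_iff)
      then have "card (x \<inter> {..<g n}) \<le> n"
        using card_mono[of "{..<m}" "x \<inter> {..<g n}"] n(3) by simp
      then show ?thesis
        using enumerate_less_iff[OF that(1), of n "g n"] by simp
    qed
    moreover have "?q \<in> cyl p m"
      by (simp add: mem_cyl_iff)
    ultimately show "\<exists>q\<in>cyl p m. \<exists>k.
        cyl q k \<inter> {x. \<not> (infinite x \<longrightarrow> (\<exists>n\<in>C. N \<le> n \<and> g n \<le> enumerate x n))} = {}"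
      using n(1,2) by (intro bexI[of _ ?q] exI[of _ "g n"]) auto
  qed
  then have "generically (\<lambda>x. (\<forall>N. infinite x \<longrightarrow> (\<exists>n\<in>C. N \<le> n \<and> g n \<le> enumerate x n)) \<and> infinite x)"
    using generically_infinite_agree[of UNIV] by (intro generically_conj generically_all) simp_all
  then show ?thesis
    by (rule generically_mono) (auto simp: infinite_nat_iff_unbounded_le)
qed

end

lemma least_card_le: "P A \<Longrightarrow> least_card P \<le>o |A|"
  using least_card_attained by metis

locale cov_meager_continuum = regular_continuum +
  assumes cov_meager_ordIso_continuum: "cov_meager =o continuum"
begin

lemma generically_exists:
  assumes "generically P"
  shows "\<exists>x. P x"
proof (rule ccontr)
  assume "\<not> (\<exists>x. P x)"
  then obtain \<M> where \<M>: "small \<M>" "\<And>M. M \<in> \<M> \<Longrightarrow> meager_in cantor M" "\<Union>\<M> = UNIV"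
    using assms by (auto simp: generically_def)
  let ?\<F> = "(\<inter>) infsets ` \<M>"
  have "meager_in (subtopology cantor infsets) (infsets \<inter> M)" if "M \<in> \<M>" for M
    using infsets_dense \<M>(2)[OF that] by (rule meager_in_dense_subtopology)
  moreover have "infsets \<subseteq> \<Union>?\<F>"
    using \<M>(3) by blast
  ultimately have "cov_meager \<le>o |?\<F>|"
    unfolding cov_meager_def by (intro least_card_le) auto
  also have "|?\<F>| <o continuum"
    using small_image[OF \<M>(1)] unfolding small_def .
  finally show False
    using cov_meager_ordIso_continuum not_ordLess_ordIso by blast
qed

text \<open>A point all of whose finite modifications satisfy \<open>P\<close> can be modified into any cylinder.\<close>

lemma generically_exists_in_cylinder:
  assumes "generically P" "C \<in> cylinders"
  shows "\<exists>x\<in>C. P x"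
proof -
  obtain p m where C: "C = cyl p m"
    using assms(2) by (auto simp: cylinders_def)
  have "generically (\<lambda>x. \<forall>F\<in>Fin. P (agree x (- F)))"
    using assms(1) by (intro generically_ball small_countable countable_Fin generically_agree)
  from generically_exists[OF this] obtain x where x: "\<And>F. F \<in> Fin \<Longrightarrow> P (agree x (- F))"
    by blast
  let ?F = "{n. n < m \<and> (n \<in> x \<longleftrightarrow> n \<notin> p)}"
  have "?F \<in> Fin"
    by (simp add: Fin_def)
  then have "P (agree x (- ?F))" by (rule x)
  moreover have "agree x (- ?F) \<in> C"
    by (auto simp: C mem_cyl_iff agree_def)
  ultimately show ?thesis by blast
qed

lemma generic_recursion:
  fixes P :: "(cont_ord \<Rightarrow> nat set) \<Rightarrow> cont_ord \<Rightarrow> nat set \<Rightarrow> bool"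
  assumes generic: "\<And>z a. generically (P z a)"
    and cong: "\<And>z z' a. (\<And>b. b < a \<Longrightarrow> z b = z' b) \<Longrightarrow> P z a = P z' a"
    and C: "\<And>a. C a \<in> cylinders"
  shows "\<exists>z. \<forall>a. P z a (z a) \<and> z a \<in> C a"
proof (rule dependent_wf_choice[where P = "\<lambda>z a x. P z a x \<and> x \<in> C a"])
  show "wf {(a, b :: cont_ord). a < b}"
    by (rule wf)
  show "(P z a x \<and> x \<in> C a) = (P z' a x \<and> x \<in> C a)"
    if "\<And>b. (b, a) \<in> {(a, b). a < b} \<Longrightarrow> z b = z' b" for z z' a x
    using cong[of a z z'] that by simp
  show "\<exists>x. P z a x \<and> x \<in> C a" for z a
    using generically_exists_in_cylinder[OF generic C] by blast
qed

end

section \<open>Ultrafilters\<close>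

definition sfip :: "'a set set \<Rightarrow> bool" where
  "sfip \<G> \<longleftrightarrow> (\<forall>\<F>\<in>Fpow \<G>. infinite (\<Inter>\<F>))"

lemma sfip_Union_chain:
  assumes "\<C> \<noteq> {}" "subset.chain \<S> \<C>" "\<And>\<G>. \<G> \<in> \<C> \<Longrightarrow> sfip \<G>"
  shows "sfip (\<Union>\<C>)"
  unfolding sfip_def
proof
  fix \<F> assume "\<F> \<in> Fpow (\<Union>\<C>)"
  then have \<F>: "finite \<F>" "\<F> \<subseteq> \<Union>\<C>"
    by (simp_all add: Fpow_def)
  obtain \<G> where "\<G> \<in> \<C>" "\<F> \<subseteq> \<G>"
    using finite_subset_Union_chain[OF \<F> assms(1,2)] by blast
  then show "infinite (\<Inter>\<F>)"
    using assms(3) \<F>(1) by (simp add: sfip_def Fpow_def)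
qed

lemma maximal_sfip_extension:
  assumes "sfip \<B>"
  obtains \<G> where "\<B> \<subseteq> \<G>" "sfip \<G>" "\<And>a. sfip (insert a \<G>) \<Longrightarrow> a \<in> \<G>"
proof -
  let ?S = "{\<G>. \<B> \<subseteq> \<G> \<and> sfip \<G>}"
  have "\<exists>\<G>\<in>?S. \<forall>\<H>\<in>?S. \<G> \<subseteq> \<H> \<longrightarrow> \<H> = \<G>"
  proof (rule subset_Zorn_nonempty)
    show "?S \<noteq> {}"
      using assms by blast
    fix \<C> assume \<C>: "\<C> \<noteq> {}" "subset.chain ?S \<C>"
    then have "\<C> \<subseteq> ?S"
      by (simp add: subset_chain_def)
    then show "\<Union>\<C> \<in> ?S"
      using sfip_Union_chain[OF \<C>] \<C>(1) by blast
  qed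
  then obtain \<G> where \<G>: "\<B> \<subseteq> \<G>" "sfip \<G>" "\<And>\<H>. \<B> \<subseteq> \<H> \<Longrightarrow> sfip \<H> \<Longrightarrow> \<G> \<subseteq> \<H> \<Longrightarrow> \<H> = \<G>"
    by auto
  show thesis
  proof (rule that[OF \<G>(1,2)])
    fix a assume "sfip (insert a \<G>)"
    then have "insert a \<G> = \<G>"
      using \<G>(1) by (intro \<G>(3)) auto
    then show "a \<in> \<G>" by blast
  qed
qed

lemma sfip_insertI:
  assumes "\<And>\<F>. \<F> \<in> Fpow \<G> \<Longrightarrow> infinite (a \<inter> \<Inter>\<F>)"
  shows "sfip (insert a \<G>)"
  unfolding sfip_def
proof
  fix \<F> assume "\<F> \<in> Fpow (insert a \<G>)"
  then have "\<F> - {a} \<in> Fpow \<G>"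
    by (auto simp: Fpow_def)
  then have "infinite (a \<inter> \<Inter>(\<F> - {a}))"
    by (rule assms)
  moreover have "a \<inter> \<Inter>(\<F> - {a}) \<subseteq> \<Inter>\<F>"
    by blast
  ultimately show "infinite (\<Inter>\<F>)"
    using finite_subset by blast
qed

lemma ultrafilter_if_maximal_sfip:
  assumes sfip: "sfip U" and max: "\<And>a. sfip (insert a U) \<Longrightarrow> a \<in> U"
  shows "ultrafilter U"
proof -
  have mem: "a \<in> U" if "\<F> \<in> Fpow U" "\<Inter>\<F> \<subseteq> a" for a \<F>
  proof (rule max, rule sfip_insertI)
    fix \<H> assume "\<H> \<in> Fpow U"
    then have "infinite (\<Inter>(\<F> \<union> \<H>))"
      using sfip \<open>\<F> \<in> Fpow U\<close> by (simp add: sfip_def Fpow_def)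
    moreover have "\<Inter>(\<F> \<union> \<H>) \<subseteq> a \<inter> \<Inter>\<H>"
      using \<open>\<Inter>\<F> \<subseteq> a\<close> by blast
    ultimately show "infinite (a \<inter> \<Inter>\<H>)"
      using finite_subset by blast
  qed
  have "a \<in> U \<or> - a \<in> U" for a
  proof (rule ccontr)
    assume "\<not> (a \<in> U \<or> - a \<in> U)"
    then obtain \<F> \<H> where finite_traces:
      "\<F> \<in> Fpow U" "finite (a \<inter> \<Inter>\<F>)" "\<H> \<in> Fpow U" "finite (- a \<inter> \<Inter>\<H>)"
      using max sfip_insertI by metis
    then have "infinite (\<Inter>(\<F> \<union> \<H>))"
      using sfip by (simp add: sfip_def Fpow_def)
    moreover have "\<Inter>(\<F> \<union> \<H>) \<subseteq> (a \<inter> \<Inter>\<F>) \<union> (- a \<inter> \<Inter>\<H>)"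
      by blast
    ultimately show False
      using finite_traces finite_subset by blast
  qed
  moreover have "infinite a" if "a \<in> U" for a
    using sfip[unfolded sfip_def, rule_format, of "{a}"] that by (simp add: Fpow_def)
  moreover have "UNIV \<in> U"
    by (rule mem[of "{}"]) (simp_all add: Fpow_def)
  moreover have "a \<inter> b \<in> U" if "a \<in> U" "b \<in> U" for a b
    using that by (intro mem[of "{a, b}"]) (simp_all add: Fpow_def)
  moreover have "b \<in> U" if "a \<in> U" "a \<subseteq> b" for a b
    using that by (intro mem[of "{a}"]) (simp_all add: Fpow_def)
  ultimately show ?thesis
    by (auto simp: ultrafilter_def infsets_def)
qed

lemma sfip_extends_to_ultrafilter:
  assumes "sfip \<B>"
  obtains U where "ultrafilter U" "\<B> \<subseteq> U"
  using maximal_sfip_extension[OF assms] ultrafilter_if_maximal_sfip by metis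

lemma sfip_UNION_if_finite:
  assumes "\<And>J. finite J \<Longrightarrow> sfip (\<Union>a\<in>J. \<A> a)"
  shows "sfip (\<Union>a. \<A> a)"
  unfolding sfip_def
proof
  fix \<F> assume \<F>: "\<F> \<in> Fpow (\<Union>a. \<A> a)"
  then have "\<forall>A\<in>\<F>. \<exists>a. A \<in> \<A> a"
    by (auto simp: Fpow_def)
  then obtain f where "\<forall>A\<in>\<F>. A \<in> \<A> (f A)"
    by metis
  then have "\<F> \<in> Fpow (\<Union>a\<in>f ` \<F>. \<A> a)"
    using \<F> by (auto simp: Fpow_def)
  moreover have "sfip (\<Union>a\<in>f ` \<F>. \<A> a)"
    using \<F> by (intro assms) (simp add: Fpow_def)
  ultimately show "infinite (\<Inter>\<F>)"
    unfolding sfip_def by blast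
qed

lemma sfip_UNION_linorder:
  fixes \<A> :: "'i::linorder \<Rightarrow> 'a set set"
  assumes infinite: "infinite (UNIV :: 'a set)"
    and step: "\<And>a \<F> \<K>. \<F> \<in> Fpow (\<Union>b<a. \<A> b) \<Longrightarrow> infinite (\<Inter>\<F>) \<Longrightarrow> \<K> \<in> Fpow (\<A> a) \<Longrightarrow>
      infinite (\<Inter>\<F> \<inter> \<Inter>\<K>)"
  shows "sfip (\<Union>a. \<A> a)"
proof (rule sfip_UNION_if_finite)
  show "sfip (\<Union>a\<in>J. \<A> a)" if "finite J" for J
    using that
  proof (induction J rule: finite_linorder_max_induct)
    case empty
    show ?case
      using infinite by (simp add: sfip_def Fpow_def)
  next
    case (insert a J)
    show ?case
      unfolding sfip_def
    proof
      fix \<F> assume \<F>: "\<F> \<in> Fpow (\<Union>b\<in>insert a J. \<A> b)"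
      let ?\<F> = "\<F> \<inter> (\<Union>b\<in>J. \<A> b)" and ?\<K> = "\<F> - (\<Union>b\<in>J. \<A> b)"
      have "?\<F> \<in> Fpow (\<Union>b\<in>J. \<A> b)"
        using \<F> by (simp add: Fpow_def)
      then have "infinite (\<Inter>?\<F>)"
        using insert.IH by (simp add: sfip_def)
      moreover have "?\<F> \<in> Fpow (\<Union>b<a. \<A> b)"
        using \<F> insert.hyps by (auto simp: Fpow_def)
      moreover have "?\<K> \<in> Fpow (\<A> a)"
        using \<F> by (auto simp: Fpow_def)
      ultimately have "infinite (\<Inter>?\<F> \<inter> \<Inter>?\<K>)"
        by (intro step)
      moreover have "\<Inter>?\<F> \<inter> \<Inter>?\<K> \<subseteq> \<Inter>\<F>"
        by blast
      ultimately show "infinite (\<Inter>\<F>)"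
        using finite_subset by blast
    qed
  qed
qed

section \<open>Scales\<close>

definition le_set :: "nat set \<Rightarrow> nat set \<Rightarrow> nat set" where
  "le_set a b = {n. enumerate a n \<le> enumerate b n}"

lemma le_mod_iff: "le_mod U a b \<longleftrightarrow> le_set a b \<in> U"
  by (simp add: le_mod_def le_set_def)

lemma le_mod_trans:
  assumes "ultrafilter U" "le_mod U a b" "le_mod U b c"
  shows "le_mod U a c"
proof -
  have "le_set a b \<inter> le_set b c \<in> U"
    using assms by (simp add: ultrafilter_def le_mod_iff)
  moreover have "le_set a b \<inter> le_set b c \<subseteq> le_set a c"
    by (auto simp: le_set_def)
  ultimately show ?thesis
    using assms(1) unfolding ultrafilter_def le_mod_iff by blast
qed

lemma not_le_mod_if_less:
  assumes "ultrafilter U" "\<And>n. enumerate b n < enumerate a n"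
  shows "\<not> le_mod U a b"
proof -
  have "le_set a b = {}"
    using assms(2) by (auto simp: le_set_def not_le)
  then show ?thesis
    using assms(1) by (auto simp: le_mod_iff ultrafilter_def infsets_def)
qed

lemma le_mod_positive_sets_refl:
  assumes "ultrafilter U"
  shows "le_mod (positive_sets U) a a"
  using assms by (auto simp: le_mod_def positive_sets_def ultrafilter_def infsets_def)

lemma unbounded_mod_if_dominating:
  assumes U: "ultrafilter U" and Z: "Z \<subseteq> infsets"
    and dom: "\<And>a. infinite a \<Longrightarrow> \<exists>z\<in>Z. le_mod U a z"
  shows "unbounded_mod U Z"
proof -
  have False if b: "\<And>z. z \<in> Z \<Longrightarrow> le_mod U z b" for b
  proof -
    obtain a where a: "infinite a" "\<And>n. Suc (enumerate b n) \<le> enumerate a n"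
      using infinite_set_with_large_enumeration[of "\<lambda>n. Suc (enumerate b n)"] by blast
    obtain z where "z \<in> Z" "le_mod U a z"
      using dom[OF a(1)] by blast
    then have "le_mod U a b"
      using b le_mod_trans[OF U] by blast
    then show False
      using not_le_mod_if_less[OF U] a(2) by (simp add: Suc_le_eq)
  qed
  then show ?thesis
    using Z unfolding unbounded_mod_def by blast
qed

context regular_continuum
begin

lemma continuum_le_bounding_number:
  fixes d z :: "cont_ord \<Rightarrow> nat set"
  assumes unbounded: "unbounded_mod U (range z)" and d: "range d = infsets"
    and le: "\<And>a b. b \<le> a \<Longrightarrow> le_mod U (d b) (z a)"
  shows "continuum \<le>o bounding_number U"
proof -
  obtain B where B: "unbounded_mod U B" "bounding_number U = |B|"
    using least_card_attained[of "unbounded_mod U", OF unbounded]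
    unfolding bounding_number_def by metis
  have "\<not> small B"
  proof
    assume "small B"
    then have "small (inv d ` B)"
      by (rule small_image)
    then obtain a where a: "inv d ` B \<subseteq> {..a}"
      by (rule small_bounded_cont_ord)
    have "le_mod U b (z a)" if "b \<in> B" for b
    proof -
      have "b \<in> range d"
        using that B(1) d by (auto simp: unbounded_mod_def)
      moreover have "inv d b \<le> a"
        using a that by blast
      ultimately show ?thesis
        using le[of "inv d b" a] by (simp add: f_inv_into_f)
    qed
    moreover have "z a \<in> infsets"
      using unbounded by (auto simp: unbounded_mod_def)
    ultimately show False
      using B(1) by (auto simp: unbounded_mod_def)
  qed
  then show ?thesis
    using Cinfinite_continuum card_of_Well_order[of B] unfolding B(2) small_def
    by (metis card_order_on_well_order_on ordLess_or_ordLeq)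
qed

lemma U_scale_range:
  fixes d z :: "cont_ord \<Rightarrow> nat set"
  assumes U: "ultrafilter U" and z: "range z \<subseteq> infsets" and d: "range d = infsets"
    and le: "\<And>a b. b \<le> a \<Longrightarrow> le_mod U (d b) (z a)"
  shows "U_scale U (range z)"
proof -
  have "\<exists>x\<in>range z. le_mod U a x" if "infinite a" for a
  proof -
    have "a \<in> range d"
      using that d by (simp add: infsets_def)
    then show ?thesis
      using le[OF order_refl] by blast
  qed
  with U z have unbounded: "unbounded_mod U (range z)"
    by (rule unbounded_mod_if_dominating)
  then have large: "continuum \<le>o bounding_number U"
    using d le by (rule continuum_le_bounding_number)
  have "\<exists>c\<in>infsets. \<exists>S\<subseteq>range z. |S| <o bounding_number U \<and>
      (\<forall>x\<in>range z - S. le_mod (positive_sets U) (d b) c \<and> le_mod U c x)" for b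
  proof (intro bexI[of _ "d b"] exI[of _ "z ` {..<b}"] conjI ballI)
    show "|z ` {..<b}| <o bounding_number U"
      using small_image[OF small_lessThan_cont_ord] large ordLess_ordLeq_trans
      unfolding small_def by blast
    show "le_mod (positive_sets U) (d b) (d b)"
      using U by (rule le_mod_positive_sets_refl)
    fix x assume "x \<in> range z - z ` {..<b}"
    then obtain a where "x = z a" "\<not> a < b" by blast
    then show "le_mod U (d b) x"
      using le by simp
  qed (use d in auto)
  moreover have "bounding_number U \<le>o |range z|"
    unfolding bounding_number_def using unbounded by (rule least_card_le)
  ultimately show ?thesis
    unfolding U_scale_def using z by (auto simp flip: d)
qed

end

section \<open>Covers by non-meager sets\<close>

lemma borel_omega_cover_extension:
  assumes S: "S \<subseteq> topspace T" and \<U>: "borel_omega_cover (subtopology T S) \<U>"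
  obtains e where "e ` \<U> \<in> countable_borel_families T" "\<And>F. F \<in> Fpow S \<Longrightarrow> \<exists>V\<in>e ` \<U>. F \<subseteq> V"
    and "\<And>V. V \<in> \<U> \<Longrightarrow> V = e V \<inter> S"
proof -
  have top: "topspace (subtopology T S) = S"
    using S by auto
  have cover: "\<exists>V\<in>\<U>. F \<subseteq> V" if "F \<in> Fpow S" for F
    using \<U> that unfolding borel_omega_cover_def top Fpow_def by blast
  have "\<U> \<subseteq> (\<lambda>W. W \<inter> S) ` borel_sets_of T"
    using \<U> by (simp add: borel_omega_cover_def borel_sets_of_subtopology[OF S])
  then have "\<forall>V\<in>\<U>. \<exists>W. W \<in> borel_sets_of T \<and> V = W \<inter> S"
    by (simp add: subset_iff image_iff Bex_def)
  from bchoice[OF this] obtain e where e: "\<forall>V\<in>\<U>. e V \<in> borel_sets_of T \<and> V = e V \<inter> S" ..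
  show thesis
  proof (rule that)
    show "e ` \<U> \<in> countable_borel_families T"
      using e \<U> cover[OF empty_in_Fpow]
      by (auto simp: countable_borel_families_def borel_omega_cover_def)
    show "\<exists>V\<in>e ` \<U>. F \<subseteq> V" if F: "F \<in> Fpow S" for F
    proof -
      obtain V where "V \<in> \<U>" "F \<subseteq> V"
        using cover[OF F] by blast
      then have "F \<subseteq> e V"
        using e by blast
      then show ?thesis
        using \<open>V \<in> \<U>\<close> by blast
    qed
    show "V = e V \<inter> S" if "V \<in> \<U>" for V
      using e that by blast
  qed
qed

lemma S1_borel_omega_subtopologyI:
  assumes S: "S \<subseteq> topspace T"
    and select: "\<And>\<V> :: nat \<Rightarrow> 'a set set. (\<And>n. \<V> n \<in> countable_borel_families T) \<Longrightarrow>
      (\<And>n F. F \<in> Fpow S \<Longrightarrow> \<exists>V\<in>\<V> n. F \<subseteq> V) \<Longrightarrow>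
      \<exists>W. (\<forall>n. W n \<in> \<V> n) \<and> (\<forall>F\<in>Fpow S. \<exists>n. F \<subseteq> W n)"
  shows "S1_borel_omega (subtopology T S)"
  unfolding S1_borel_omega_def
proof (intro allI impI)
  let ?T = "subtopology T S"
  have top: "topspace ?T = S"
    using S by auto
  fix \<U> :: "nat \<Rightarrow> 'a set set"
  assume \<U>: "\<forall>n. borel_omega_cover ?T (\<U> n)"
  have "\<exists>e. e ` \<U> n \<in> countable_borel_families T \<and> (\<forall>F\<in>Fpow S. \<exists>V\<in>e ` \<U> n. F \<subseteq> V) \<and>
      (\<forall>V\<in>\<U> n. V = e V \<inter> S)" for n
    using borel_omega_cover_extension[OF S \<U>[rule_format, of n]] by metis
  then obtain e where e: "\<And>n. e n ` \<U> n \<in> countable_borel_families T"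
    "\<And>n F. F \<in> Fpow S \<Longrightarrow> \<exists>V\<in>e n ` \<U> n. F \<subseteq> V" "\<And>n V. V \<in> \<U> n \<Longrightarrow> V = e n V \<inter> S"
    by metis
  have "\<exists>W. (\<forall>n. W n \<in> e n ` \<U> n) \<and> (\<forall>F\<in>Fpow S. \<exists>n. F \<subseteq> W n)"
    using e(1,2) by (intro select)
  then obtain W where W: "\<forall>n. W n \<in> e n ` \<U> n" "\<forall>F\<in>Fpow S. \<exists>n. F \<subseteq> W n"
    by (elim exE conjE)
  have "\<forall>n. \<exists>V. V \<in> \<U> n \<and> W n = e n V"
    using W(1) by (auto simp: image_iff)
  then obtain V where V: "\<And>n. V n \<in> \<U> n" "\<And>n. W n = e n (V n)"
    by metis
  have "V n = W n \<inter> S" for n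
    using e(3)[OF V(1)] by (simp add: V(2))
  then have "\<exists>n. F \<subseteq> V n" if "F \<in> Fpow S" for F
    using W(2) that by (simp add: Fpow_def)
  moreover have "V n \<in> borel_sets_of ?T" "V n \<noteq> S" for n
    using V(1)[of n] \<U>[rule_format, of n] unfolding borel_omega_cover_def top by blast+
  ultimately have "borel_omega_cover ?T (range V)"
    unfolding borel_omega_cover_def top by (auto simp: Fpow_def)
  with V(1) show "\<exists>V. (\<forall>n. V n \<in> \<U> n) \<and> borel_omega_cover ?T (range V)"
    by blast
qed

definition nonmeagerly_covers :: "nat set set set \<Rightarrow> nat set set \<Rightarrow> bool" where
  "nonmeagerly_covers \<V> F \<longleftrightarrow>
     (\<forall>\<C>\<in>Fpow cylinders. \<exists>V\<in>\<V>. F \<subseteq> V \<and> (\<forall>C\<in>\<C>. \<not> meager_in cantor (V \<inter> C)))"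

lemma nonmeagerly_covers_imp_covers: "nonmeagerly_covers \<V> F \<Longrightarrow> \<exists>V\<in>\<V>. F \<subseteq> V"
  unfolding nonmeagerly_covers_def by (metis empty_in_Fpow)

definition meets_nonmeagerly :: "nat set set set \<Rightarrow> nat set \<Rightarrow> bool" where
  "meets_nonmeagerly \<V> x \<longleftrightarrow>
     (\<forall>V\<in>\<V>. \<forall>C\<in>cylinders. x \<in> V \<inter> C \<longrightarrow> \<not> meager_in cantor (V \<inter> C))"

lemma nonmeagerly_covers_if_omega_cover:
  assumes cover: "\<And>F. F \<in> Fpow X \<Longrightarrow> \<exists>V\<in>\<V>. F \<subseteq> V"
    and dense: "\<And>C. C \<in> cylinders \<Longrightarrow> \<exists>x\<in>X \<inter> C. meets_nonmeagerly \<V> x"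
    and F: "F \<in> Fpow X"
  shows "nonmeagerly_covers \<V> F"
  unfolding nonmeagerly_covers_def
proof
  fix \<C> assume \<C>: "\<C> \<in> Fpow cylinders"
  obtain x where x: "\<And>C. C \<in> cylinders \<Longrightarrow> x C \<in> X \<inter> C \<and> meets_nonmeagerly \<V> (x C)"
    using dense by metis
  have "F \<union> x ` \<C> \<in> Fpow X"
    using F \<C> x by (auto simp: Fpow_def)
  then obtain V where V: "V \<in> \<V>" "F \<union> x ` \<C> \<subseteq> V"
    using cover by blast
  have "\<not> meager_in cantor (V \<inter> C)" if "C \<in> \<C>" for C
  proof -
    have "C \<in> cylinders"
      using that \<C> by (auto simp: Fpow_def)
    then show ?thesis
      using x V that unfolding meets_nonmeagerly_def by blast
  qed
  with V show "\<exists>V\<in>\<V>. F \<subseteq> V \<and> (\<forall>C\<in>\<C>. \<not> meager_in cantor (V \<inter> C))"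
    by blast
qed

definition preserves_cover :: "nat set set set \<Rightarrow> nat set set \<Rightarrow> nat set \<Rightarrow> bool" where
  "preserves_cover \<V> E x \<longleftrightarrow>
     (\<forall>F\<in>Fpow E. nonmeagerly_covers \<V> F \<longrightarrow> nonmeagerly_covers \<V> (insert x F))"

context regular_continuum
begin

lemma generically_meets_nonmeagerly:
  assumes "countable \<V>"
  shows "generically (meets_nonmeagerly \<V>)"
  unfolding meets_nonmeagerly_def
proof (intro generically_ball small_countable assms countable_cylinders)
  fix V C :: "nat set set"
  show "generically (\<lambda>x. x \<in> V \<inter> C \<longrightarrow> \<not> meager_in cantor (V \<inter> C))"
    by (cases "meager_in cantor (V \<inter> C)") (simp_all add: generically_comeager flip: Int_def)
qed

text \<open>Non-meagerness in finitely many cylinders leaves room for one cylinder more; together with the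
  Baire property this makes comeager the union of the members that qualify.\<close>

lemma generically_nonmeagerly_covers_insert:
  assumes \<V>: "countable \<V>" "\<And>V. V \<in> \<V> \<Longrightarrow> Baire_property_in cantor V"
    and F: "nonmeagerly_covers \<V> F"
  shows "generically (\<lambda>x. nonmeagerly_covers \<V> (insert x F))"
  unfolding nonmeagerly_covers_def
proof (intro generically_ball small_countable countable_Fpow countable_cylinders)
  fix \<C> assume \<C>: "\<C> \<in> Fpow cylinders"
  define \<W> where "\<W> = {V \<in> \<V>. F \<subseteq> V \<and> (\<forall>C\<in>\<C>. \<not> meager_in cantor (V \<inter> C))}"
  have "countable \<W>" "\<And>V. V \<in> \<W> \<Longrightarrow> Baire_property_in cantor V"
    using \<V> by (auto simp: \<W>_def)
  then have "Baire_property_in cantor (\<Union>V\<in>\<W>. V)"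
    by (rule Baire_property_in_UNION)
  moreover have "\<not> meager_in cantor ((\<Union>V\<in>\<W>. V) \<inter> U)" if U: "openin cantor U" "U \<noteq> {}" for U
  proof -
    obtain C where C: "C \<in> cylinders" "C \<subseteq> U"
      using openin_cantor_contains_cylinder[OF U] by blast
    then have "insert C \<C> \<in> Fpow cylinders"
      using \<C> by (simp add: Fpow_def)
    with F have "\<exists>V\<in>\<V>. F \<subseteq> V \<and> (\<forall>C\<in>insert C \<C>. \<not> meager_in cantor (V \<inter> C))"
      unfolding nonmeagerly_covers_def by (rule bspec)
    then obtain V where V: "V \<in> \<W>" "\<not> meager_in cantor (V \<inter> C)"
      by (auto simp: \<W>_def)
    then have "V \<inter> C \<subseteq> (\<Union>V\<in>\<W>. V) \<inter> U"
      using C(2) by blast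
    with V(2) show ?thesis
      using meager_in_subset by blast
  qed
  ultimately have "meager_in cantor (topspace cantor - (\<Union>V\<in>\<W>. V))"
    by (rule Baire_property_in_comeager)
  then have "generically (\<lambda>x. x \<in> (\<Union>V\<in>\<W>. V))"
    by (intro generically_comeager) (simp add: set_diff_eq)
  then show "generically (\<lambda>x. \<exists>V\<in>\<V>. insert x F \<subseteq> V \<and> (\<forall>C\<in>\<C>. \<not> meager_in cantor (V \<inter> C)))"
    by (rule generically_mono) (auto simp: \<W>_def)
qed

lemma generically_preserves_cover:
  assumes "small E" "countable \<V>" "\<And>V. V \<in> \<V> \<Longrightarrow> Baire_property_in cantor V"
  shows "generically (preserves_cover \<V> E)"
  unfolding preserves_cover_def
  using assms
  by (intro generically_ball generically_imp small_Fpow generically_nonmeagerly_covers_insert)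

end

definition good_selection ::
  "(nat \<Rightarrow> nat set set set) \<Rightarrow> nat set set \<Rightarrow> (nat \<Rightarrow> nat set set) \<Rightarrow> bool" where
  "good_selection \<V> E W \<longleftrightarrow> (\<forall>n. W n \<in> \<V> n) \<and>
     (\<forall>F\<in>Fpow E. (\<forall>n. nonmeagerly_covers (\<V> n) F) \<longrightarrow> nonmeagerly_covers (range W) F)"

lemma (in cov_meager_continuum) good_selection_exists:
  assumes E: "small E" and \<V>: "\<And>n. countable (\<V> n)" "\<And>n. \<V> n \<noteq> {}"
  shows "\<exists>W. good_selection \<V> E W"
proof -
  define V where "V n = from_nat_into (\<V> n)" for n
  have V: "range (V n) = \<V> n" for n
    unfolding V_def using \<V> by (intro range_from_nat_into)
  let ?Q = "\<lambda>F \<C> n i. F \<subseteq> V n i \<and> (\<forall>C\<in>\<C>. \<not> meager_in cantor (V n i \<inter> C))"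
  have "generically (\<lambda>s. \<forall>F\<in>Fpow E. \<forall>\<C>\<in>Fpow cylinders.
      (\<forall>n. \<exists>i. ?Q F \<C> n i) \<longrightarrow> (\<exists>n. ?Q F \<C> n (selector s n)))"
    by (intro generically_ball generically_imp generically_selector small_Fpow[OF E]
        small_countable countable_Fpow countable_cylinders) blast
  from generically_exists[OF this] obtain s where s: "\<forall>F\<in>Fpow E. \<forall>\<C>\<in>Fpow cylinders.
      (\<forall>n. \<exists>i. ?Q F \<C> n i) \<longrightarrow> (\<exists>n. ?Q F \<C> n (selector s n))" ..
  have "nonmeagerly_covers (range (\<lambda>n. V n (selector s n))) F"
    if F: "F \<in> Fpow E" "\<And>n. nonmeagerly_covers (\<V> n) F" for F
    unfolding nonmeagerly_covers_def
  proof
    fix \<C> assume \<C>: "\<C> \<in> Fpow cylinders"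
    have "\<exists>i. ?Q F \<C> n i" for n
      using F(2)[of n] \<C> unfolding nonmeagerly_covers_def V[symmetric] by simp
    then have "\<exists>n. ?Q F \<C> n (selector s n)"
      using s F(1) \<C> by simp
    then show "\<exists>V\<in>range (\<lambda>n. V n (selector s n)). F \<subseteq> V \<and> (\<forall>C\<in>\<C>. \<not> meager_in cantor (V \<inter> C))"
      by simp
  qed
  then have "good_selection \<V> E (\<lambda>n. V n (selector s n))"
    by (simp add: good_selection_def flip: V)
  then show ?thesis by blast
qed

section \<open>Generic sequences\<close>

definition dominates_along :: "nat set set \<Rightarrow> nat set set \<Rightarrow> nat set \<Rightarrow> bool" where
  "dominates_along \<G> D x \<longleftrightarrow> (\<forall>\<F>\<in>Fpow \<G>. infinite (\<Inter>\<F>) \<longrightarrow>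
     (\<forall>K\<in>Fpow D. infinite (\<Inter>\<F> \<inter> (\<Inter>b\<in>K. le_set b x))))"

lemma (in regular_continuum) generically_dominates_along:
  assumes "small \<G>" "small D"
  shows "generically (dominates_along \<G> D)"
  unfolding dominates_along_def
proof (intro generically_ball generically_imp small_Fpow assms)
  fix \<F> K assume \<F>: "infinite (\<Inter>\<F> :: nat set)" and K: "K \<in> Fpow D"
  have "generically (\<lambda>x. infinite {n \<in> \<Inter>\<F>. (\<Sum>b\<in>K. enumerate b n) \<le> enumerate x n})"
    using \<F> by (rule generically_enumerate_ge)
  then show "generically (\<lambda>x. infinite (\<Inter>\<F> \<inter> (\<Inter>b\<in>K. le_set b x)))"
  proof (rule generically_mono)
    fix x assume infinite: "infinite {n \<in> \<Inter>\<F>. (\<Sum>b\<in>K. enumerate b n) \<le> enumerate x n}"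
    have "enumerate b n \<le> enumerate x n" if "(\<Sum>b\<in>K. enumerate b n) \<le> enumerate x n" "b \<in> K" for b n
    proof -
      have "enumerate b n \<le> (\<Sum>b\<in>K. enumerate b n)"
        using K \<open>b \<in> K\<close> by (intro member_le_sum) (simp_all add: Fpow_def)
      also note that(1)
      finally show ?thesis .
    qed
    then have "{n \<in> \<Inter>\<F>. (\<Sum>b\<in>K. enumerate b n) \<le> enumerate x n} \<subseteq> \<Inter>\<F> \<inter> (\<Inter>b\<in>K. le_set b x)"
      by (auto simp: le_set_def)
    with infinite show "infinite (\<Inter>\<F> \<inter> (\<Inter>b\<in>K. le_set b x))"
      using finite_subset by blast
  qed
qed

definition earlier :: "(cont_ord \<Rightarrow> nat set) \<Rightarrow> cont_ord \<Rightarrow> nat set set" where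
  "earlier z a = z ` {..<a} \<union> Fin"

lemma small_earlier: "small (earlier z a)"
  unfolding earlier_def
  by (intro small_Un small_image small_lessThan_cont_ord small_countable countable_Fin)

lemma earlier_cong:
  assumes "\<And>b. b < a \<Longrightarrow> z b = z' b" "c \<le> a"
  shows "earlier z c = earlier z' c"
proof -
  have "z ` {..<c} = z' ` {..<c}"
    using assms by (intro image_cong) auto
  then show ?thesis
    by (simp add: earlier_def)
qed

locale generic_construction = cov_meager_continuum +
  fixes d :: "cont_ord \<Rightarrow> nat set" and \<B> :: "cont_ord \<Rightarrow> nat \<Rightarrow> nat set set set"
  assumes range_d: "range d = infsets"
    and range_\<B>: "range \<B> = {\<V>. \<forall>n. \<V> n \<in> countable_borel_families cantor}"
begin

lemma \<B>_countable_borel: "\<B> b n \<in> countable_borel_families cantor"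
  using range_\<B> by blast

text \<open>A chosen selection is a function of the earlier points: only the points are constructed by
  recursion.\<close>

definition selected :: "(cont_ord \<Rightarrow> nat set) \<Rightarrow> cont_ord \<Rightarrow> nat \<Rightarrow> nat set set" where
  "selected z b = (SOME W. good_selection (\<B> b) (earlier z b) W)"

definition le_sets :: "(cont_ord \<Rightarrow> nat set) \<Rightarrow> cont_ord \<Rightarrow> nat set set" where
  "le_sets z a = (\<lambda>b. le_set b (z a)) ` d ` {..a}"

definition generic_at :: "(cont_ord \<Rightarrow> nat set) \<Rightarrow> cont_ord \<Rightarrow> nat set \<Rightarrow> bool" where
  "generic_at z a x \<longleftrightarrow> infinite x
     \<and> (\<forall>b\<in>{..a}. \<forall>n. meets_nonmeagerly (\<B> b n) x)
     \<and> (\<forall>b\<in>{..a}. preserves_cover (range (selected z b)) (earlier z a) x)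
     \<and> dominates_along (\<Union>c<a. le_sets z c) (d ` {..a}) x"

lemma good_selection_selected: "good_selection (\<B> b) (earlier z b) (selected z b)"
proof -
  have "\<exists>W. good_selection (\<B> b) (earlier z b) W"
    using \<B>_countable_borel
    by (intro good_selection_exists small_earlier) (auto simp: countable_borel_families_def)
  then show ?thesis
    unfolding selected_def by (rule someI_ex)
qed

lemma generically_generic_at: "generically (generic_at z a)"
proof -
  have "Baire_property_in cantor V" if "V \<in> range (selected z b)" for V b
    using that good_selection_selected[of b z] \<B>_countable_borel[of b]
    by (auto simp: good_selection_def countable_borel_families_def
        intro!: Baire_property_in_borel_sets_of)
  then have "generically (preserves_cover (range (selected z b)) (earlier z a))" for b
    by (intro generically_preserves_cover small_earlier) simp_all
  moreover have "generically (meets_nonmeagerly (\<B> b n))" for b n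
    using \<B>_countable_borel
    by (intro generically_meets_nonmeagerly) (simp add: countable_borel_families_def)
  moreover have "generically (dominates_along (\<Union>c<a. le_sets z c) (d ` {..a}))"
    unfolding le_sets_def by (intro generically_dominates_along small_UNION small_image
        small_lessThan_cont_ord small_atMost_cont_ord)
  moreover have "generically infinite"
    using generically_infinite_agree[of UNIV] by simp
  ultimately show ?thesis
    unfolding generic_at_def
    by (intro generically_conj generically_ball generically_all small_atMost_cont_ord)
qed

lemma generic_at_cong:
  assumes "\<And>b. b < a \<Longrightarrow> z b = z' b"
  shows "generic_at z a = generic_at z' a"
proof -
  have "selected z b = selected z' b" if "b \<le> a" for b
    using earlier_cong[OF assms that] by (simp add: selected_def)
  moreover have "le_sets z c = le_sets z' c" if "c < a" for c
    using assms[OF that] by (simp add: le_sets_def)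
  ultimately show ?thesis
    using earlier_cong[OF assms, of a] by (simp add: generic_at_def fun_eq_iff)
qed

end

locale generic_sequence = generic_construction +
  fixes z :: "cont_ord \<Rightarrow> nat set"
  assumes generic: "generic_at z a (z a)"
    and dense: "C \<in> cylinders \<Longrightarrow> \<exists>a\<ge>b. z a \<in> C"
begin

lemma range_subset_infsets: "range z \<subseteq> infsets"
  using generic by (auto simp: generic_at_def infsets_def)

lemma U_scale_exists: "\<exists>U. ultrafilter U \<and> U_scale U (range z)"
proof -
  have "sfip (\<Union>a. le_sets z a)"
  proof (rule sfip_UNION_linorder)
    fix a \<F> \<K>
    assume \<F>: "\<F> \<in> Fpow (\<Union>b<a. le_sets z b)" "infinite (\<Inter>\<F>)" and "\<K> \<in> Fpow (le_sets z a)"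
    then obtain K where "K \<in> Fpow (d ` {..a})" "\<K> = (\<lambda>b. le_set b (z a)) ` K"
      unfolding le_sets_def Fpow_def by (auto dest: finite_subset_image)
    with \<F> show "infinite (\<Inter>\<F> \<inter> \<Inter>\<K>)"
      using generic[of a] by (auto simp: generic_at_def dominates_along_def)
  qed simp
  then obtain U where U: "ultrafilter U" "(\<Union>a. le_sets z a) \<subseteq> U"
    by (rule sfip_extends_to_ultrafilter)
  have "le_mod U (d b) (z a)" if "b \<le> a" for a b
    using U(2) that unfolding le_mod_iff le_sets_def by blast
  with U(1) show ?thesis
    using U_scale_range[OF U(1) range_subset_infsets range_d] by blast
qed

lemma nonmeagerly_covers_selected:
  assumes A: "A \<subseteq> Fin"
    and cover: "\<And>n F. F \<in> Fpow (range z \<union> A) \<Longrightarrow> nonmeagerly_covers (\<B> b n) F"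
    and F: "F \<in> Fpow A" and J: "finite J"
  shows "nonmeagerly_covers (range (selected z b)) (z ` J \<union> F)"
proof -
  have earlier_case: "nonmeagerly_covers (range (selected z b)) (z ` J \<union> F)"
    if "finite J" "J \<subseteq> {..<b}" for J
  proof -
    have "z ` J \<union> F \<in> Fpow (earlier z b)"
      using that F A by (auto simp: Fpow_def earlier_def)
    moreover have "nonmeagerly_covers (\<B> b n) (z ` J \<union> F)" for n
      using that F by (intro cover) (auto simp: Fpow_def)
    ultimately show ?thesis
      using good_selection_selected[of b z] by (auto simp: good_selection_def)
  qed
  show ?thesis
    using J
  proof (induction J rule: finite_linorder_max_induct)
    case empty
    show ?case
      by (rule earlier_case) simp_all
  next
    case (insert a J)
    show ?case
    proof (cases "a < b")
      case True
      with insert.hyps show ?thesis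
        by (intro earlier_case) auto
    next
      case False
      then have "preserves_cover (range (selected z b)) (earlier z a) (z a)"
        using generic[of a] by (simp add: generic_at_def)
      moreover have "z ` J \<union> F \<in> Fpow (earlier z a)"
        using insert.hyps F A by (auto simp: Fpow_def earlier_def)
      ultimately show ?thesis
        using insert.IH by (simp add: preserves_cover_def)
    qed
  qed
qed

lemma S1_borel_omega_range_Un:
  assumes A: "A \<subseteq> Fin"
  shows "S1_borel_omega (subtopology cantor (range z \<union> A))"
proof (rule S1_borel_omega_subtopologyI)
  fix \<V> :: "nat \<Rightarrow> nat set set set"
  assume "\<And>n. \<V> n \<in> countable_borel_families cantor"
    and cover: "\<And>n F. F \<in> Fpow (range z \<union> A) \<Longrightarrow> \<exists>V\<in>\<V> n. F \<subseteq> V"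
  then have "\<V> \<in> range \<B>"
    by (simp add: range_\<B>)
  then obtain b where b: "\<V> = \<B> b" by blast
  have "\<exists>x\<in>(range z \<union> A) \<inter> C. meets_nonmeagerly (\<V> n) x" if "C \<in> cylinders" for C n
  proof -
    obtain a where "b \<le> a" "z a \<in> C"
      using dense[OF \<open>C \<in> cylinders\<close>] by blast
    then show ?thesis
      using generic[of a] by (intro bexI[of _ "z a"]) (auto simp: generic_at_def b)
  qed
  then have covers: "nonmeagerly_covers (\<B> b n) F" if "F \<in> Fpow (range z \<union> A)" for n F
    unfolding b[symmetric] using cover that
    by (intro nonmeagerly_covers_if_omega_cover[of "range z \<union> A"])
  have "\<exists>n. F \<subseteq> selected z b n" if F: "F \<in> Fpow (range z \<union> A)" for F
  proof -
    have F': "finite F" "F \<subseteq> range z \<union> A"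
      using F by (simp_all add: Fpow_def)
    obtain J where J: "finite J" "F \<inter> range z = z ` J"
      using finite_subset_image[of "F \<inter> range z" z UNIV] F'(1) by auto
    have "F \<inter> A \<in> Fpow A"
      using F' by (simp add: Fpow_def)
    then have "nonmeagerly_covers (range (selected z b)) (z ` J \<union> (F \<inter> A))"
      using covers J(1) by (intro nonmeagerly_covers_selected[OF A])
    also have "z ` J \<union> (F \<inter> A) = F"
      using F'(2) by (auto simp flip: J(2))
    finally show ?thesis
      using nonmeagerly_covers_imp_covers by fastforce
  qed
  moreover have "selected z b n \<in> \<V> n" for n
    using good_selection_selected[of b z] by (simp add: good_selection_def b)
  ultimately show "\<exists>W. (\<forall>n. W n \<in> \<V> n) \<and> (\<forall>F\<in>Fpow (range z \<union> A). \<exists>n. F \<subseteq> W n)"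
    by blast
qed simp

end

lemma infinite_agree_Fin:
  assumes "F \<in> Fin" "G \<in> Fin"
  shows "infinite (agree F G)"
proof -
  have "infinite (- (F \<union> G))"
    using assms by (simp add: Fin_def Compl_eq_Diff_UNIV)
  moreover have "- (F \<union> G) \<subseteq> agree F G"
    by (auto simp: agree_def)
  ultimately show ?thesis
    using finite_subset by blast
qed

lemma infinite_agree_if_earlier:
  assumes "\<And>a. infinite (agree (x a) (y a))"
    and x: "\<And>a w. w \<in> earlier y a \<Longrightarrow> infinite (agree (x a) w)"
    and y: "\<And>a w. w \<in> earlier x a \<Longrightarrow> infinite (agree (y a) w)"
    and "u \<in> range x \<union> Fin" "v \<in> range y \<union> Fin"
  shows "infinite (agree u v)"
proof -
  have "infinite (agree (x a) (y b))" for a b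
  proof (cases a b rule: linorder_cases)
    case less
    then show ?thesis
      using y[of "x a" b] by (simp add: earlier_def agree_commute)
  next
    case equal
    then show ?thesis
      using assms(1) by simp
  next
    case greater
    then show ?thesis
      using x[of "y b" a] by (simp add: earlier_def)
  qed
  moreover have "infinite (agree (x a) w)" "infinite (agree w (y a))" if "w \<in> Fin" for a w
    using x[of w a] y[of w a] that by (simp_all add: earlier_def agree_commute)
  ultimately show ?thesis
    using assms(4,5) infinite_agree_Fin by auto
qed

definition translate ::
  "('i \<Rightarrow> cont_ord \<Rightarrow> nat set) \<Rightarrow> (cont_ord \<Rightarrow> nat set) \<Rightarrow> 'i \<Rightarrow> cont_ord \<Rightarrow> nat set" where
  "translate D x i a = agree (x a) (D i a)"

context generic_construction
begin

definition translates_generic_at ::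
  "('i \<Rightarrow> cont_ord \<Rightarrow> nat set) \<Rightarrow> (cont_ord \<Rightarrow> nat set) \<Rightarrow> cont_ord \<Rightarrow> nat set \<Rightarrow> bool" where
  "translates_generic_at D x a u \<longleftrightarrow> (\<forall>i. generic_at (translate D x i) a (agree u (D i a))) \<and>
     (\<forall>i j. \<forall>w\<in>earlier (translate D x j) a. infinite (agree (agree u (D i a)) w))"

lemma generically_translates_generic_at:
  fixes D :: "'i::countable \<Rightarrow> cont_ord \<Rightarrow> nat set"
  shows "generically (translates_generic_at D x a)"
  unfolding translates_generic_at_def
  by (intro generically_conj generically_all generically_ball small_earlier generically_generic_at
      generically_infinite_agree generically_agree[of "generic_at _ _"]
      generically_agree[of "\<lambda>u. infinite (agree u _)"])

lemma translates_generic_at_cong: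
  assumes "\<And>b. b < a \<Longrightarrow> x b = x' b"
  shows "translates_generic_at D x a = translates_generic_at D x' a"
proof -
  have eq: "translate D x i b = translate D x' i b" if "b < a" for i b
    using assms[OF that] by (simp add: translate_def)
  show ?thesis
    using generic_at_cong[OF eq] earlier_cong[OF eq order_refl]
    by (simp add: translates_generic_at_def fun_eq_iff)
qed

lemma generic_translates:
  fixes D :: "'i::countable \<Rightarrow> cont_ord \<Rightarrow> nat set"
  obtains x where "\<And>i. generic_sequence d \<B> (translate D x i)"
    and "\<And>i j a w. w \<in> earlier (translate D x j) a \<Longrightarrow> infinite (agree (translate D x i a) w)"
proof -
  have "countable ((UNIV :: 'i set) \<times> cylinders)" "(UNIV :: 'i set) \<times> cylinders \<noteq> {}"
    using countable_cylinders by (auto simp: cylinders_def)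
  then obtain tag :: "cont_ord \<Rightarrow> 'i \<times> nat set set" where tag: "\<And>a. tag a \<in> UNIV \<times> cylinders"
    "\<And>t b. t \<in> UNIV \<times> cylinders \<Longrightarrow> \<exists>a\<ge>b. tag a = t"
    by (rule cofinal_tagging) blast
  define C where "C a = (\<lambda>u. agree u (D (fst (tag a)) a)) -` snd (tag a)" for a
  have "C a \<in> cylinders" for a
    using tag(1)[of a] unfolding C_def by (intro agree_vimage_cylinder) auto
  then have "\<exists>x. \<forall>a. translates_generic_at D x a (x a) \<and> x a \<in> C a"
    by (intro generic_recursion generically_translates_generic_at translates_generic_at_cong)
  then obtain x where x: "\<And>a. translates_generic_at D x a (x a)" "\<And>a. x a \<in> C a"
    by blast
  show thesis
  proof (rule that)
    show "generic_sequence d \<B> (translate D x i)" for i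
    proof unfold_locales
      show "generic_at (translate D x i) a (translate D x i a)" for a
        using x(1)[of a] by (simp add: translates_generic_at_def translate_def[of D x i a])
      show "\<exists>a\<ge>b. translate D x i a \<in> K" if K: "K \<in> cylinders" for K b
      proof -
        obtain a where "a \<ge> b" "tag a = (i, K)"
          using tag(2)[of "(i, K)" b] K by auto
        then show ?thesis
          using x(2)[of a] by (auto simp: C_def translate_def)
      qed
    qed
    show "infinite (agree (translate D x i a) w)" if "w \<in> earlier (translate D x j) a" for i j a w
      using x(1)[of a] that by (simp add: translates_generic_at_def translate_def[of D x i a])
  qed
qed

lemma generic_pair:
  obtains x y where "generic_sequence d \<B> x" "generic_sequence d \<B> y"
    and "\<And>A. A \<subseteq> Fin \<Longrightarrow> (\<lambda>(u, v). agree u v) ` ((range x \<union> A) \<times> (range y \<union> A)) = infsets"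
proof -
  let ?D = "\<lambda>i a. if i then d a else UNIV"
  obtain x where generic: "\<And>i. generic_sequence d \<B> (translate ?D x i)"
    and infinite: "\<And>i j a w. w \<in> earlier (translate ?D x j) a \<Longrightarrow>
      infinite (agree (translate ?D x i a) w)"
    using generic_translates[of ?D] by blast
  define y where "y = translate ?D x True"
  have x: "translate ?D x False = x"
    by (simp add: translate_def fun_eq_iff)
  have xy: "agree (x a) (y a) = d a" for a
    by (simp add: y_def translate_def)
  have "infinite (agree u v)" if "u \<in> range x \<union> Fin" "v \<in> range y \<union> Fin" for u v
  proof (rule infinite_agree_if_earlier[OF _ _ _ that])
    show "infinite (agree (x a) (y a))" for a
      using range_d by (auto simp: xy infsets_def)
    show "infinite (agree (x a) w)" if "w \<in> earlier y a" for a w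
      using that by (rule infinite[of w True a False, folded y_def, unfolded x])
    show "infinite (agree (y a) w)" if "w \<in> earlier x a" for a w
      using that by (rule infinite[of w False a True, folded y_def, unfolded x])
  qed
  then have "(\<lambda>(u, v). agree u v) ` ((range x \<union> A) \<times> (range y \<union> A)) = infsets" if "A \<subseteq> Fin" for A
  proof (intro equalityI)
    show "infsets \<subseteq> (\<lambda>(u, v). agree u v) ` ((range x \<union> A) \<times> (range y \<union> A))"
      using xy unfolding range_d[symmetric] by (force simp: image_iff)
  qed (use that in \<open>auto simp: infsets_def\<close>)
  moreover have "generic_sequence d \<B> x" "generic_sequence d \<B> y"
    using generic[of False] generic[of True] by (simp_all only: x y_def)
  ultimately show thesis
    by (intro that)
qed

end

theorem theorem5p1:
  assumes "cov_meager =o continuum"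
    and "regularCard continuum"
  shows "\<exists>U U' X Y. ultrafilter U \<and> ultrafilter U' \<and> U_scale U X \<and> U_scale U' Y \<and>
    S1_borel_omega (subtopology cantor (X \<union> Fin)) \<and>
    S1_borel_omega (subtopology cantor (Y \<union> Fin)) \<and>
    \<not> Menger_space (prod_topology (subtopology cantor (X \<union> Fin)) (subtopology cantor (Y \<union> Fin))) \<and>
    S1_borel_omega (subtopology cantor X) \<and>
    S1_borel_omega (subtopology cantor Y) \<and>
    \<not> Menger_space (prod_topology (subtopology cantor X) (subtopology cantor Y))"
proof -
  interpret cov_meager_continuum
    using assms by unfold_locales
  obtain d :: "cont_ord \<Rightarrow> nat set" where "range d = infsets"
    by (rule enumeration_of_infsets)
  moreover obtain \<B> :: "cont_ord \<Rightarrow> nat \<Rightarrow> nat set set set"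
    where "range \<B> = {\<V>. \<forall>n. \<V> n \<in> countable_borel_families cantor}"
    by (rule enumeration_of_borel_family_sequences[OF second_countable_cantor])
  ultimately interpret generic_construction d \<B>
    by unfold_locales
  obtain x y where "generic_sequence d \<B> x" "generic_sequence d \<B> y"
    and agree: "\<And>A. A \<subseteq> Fin \<Longrightarrow> (\<lambda>(u, v). agree u v) ` ((range x \<union> A) \<times> (range y \<union> A)) = infsets"
    using generic_pair by blast
  then interpret x: generic_sequence d \<B> x + y: generic_sequence d \<B> y
    by simp_all
  show ?thesis
    using x.U_scale_exists y.U_scale_exists
      x.S1_borel_omega_range_Un[of Fin] y.S1_borel_omega_range_Un[of Fin]
      x.S1_borel_omega_range_Un[of "{}"] y.S1_borel_omega_range_Un[of "{}"]
      not_Menger_space_prod[OF agree[of Fin]] not_Menger_space_prod[OF agree[of "{}"]]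
    by auto
qed

end
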